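(* Let $n>1$, and let $V$ be a complete holomorphic vector field on $\mathbb{C}^n$ with flow $\{\phi_t\}$ such that $0\in\mathbb{C}^n$ is a globally attracting fixed point of $V$. Let $\Omega\subset\mathbb{C}^n$ be a domain with $0\in\Omega$ which is invariant under the positive time flow of $V$. Then every biholomorphic map $F:\Omega\to\Omega'$ onto a Runge domain $\Omega'\subset\mathbb{C}^n$ can be approximated uniformly on compacts in $\Omega$ by holomorphic automorphisms of $\mathbb{C}^n$; that is, for every compact set $K\subset\Omega$ and every $\eta>0$ there is a holomorphic automorphism $\Phi$ of $\mathbb{C}^n$ with $\sup_{z\in K}|\Phi(z)-F(z)|<\eta$.
   Context: A holomorphic vector field $V$ on $\mathbb{C}^n$ is complete if its flow $\phi_t(z)$, the solution of $\frac{d}{dt}\phi_t(z)=V(\phi_t(z))$, $\phi_0(z)=z$, exists for every $z\in\mathbb{C}^n$ and all $t\in\mathbb{R}$. Let $\mathbb{B}(0,\epsilon)$ denote the ball of radius $\epsilon$ around the origin in $\mathbb{C}^n$. The point $0$ is a globally attracting fixed point of $V$ if $V(0)=0$ and: (1) $\lim_{t\to+\infty}\phi_t(z)=0$ for all $z\in\mathbb{C}^n$; and (2) for every $\epsilon>0$ there is a $\delta>0$ such that $\phi_t(z)\in\mathbb{B}(0,\epsilon)$ for every $z\in\mathbb{B}(0,\delta)$ and every $t\ge 0$. A domain $\Omega\subset\mathbb{C}^n$ is invariant under the positive time flow of $V$ if $\phi_t(z)\in\Omega$ for every $z\in\Omega$ and $t\ge 0$. A domain $D\subset\mathbb{C}^n$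 is Runge (in $\mathbb{C}^n$) if the restrictions to $D$ of holomorphic polynomials on $\mathbb{C}^n$ form a dense subset of the space $\mathcal{O}(D)$ of holomorphic functions on $D$ (in the topology of uniform convergence on compacts). Domains are not assumed to be pseudoconvex. *)

theory Defs
  imports "HOL-Analysis.Analysis"
begin

text \<open>
  Complex \<open>n\<close>-space is \<^typ>\<open>complex ^ 'n\<close> with \<open>n = CARD('n)\<close>; its library norm is the Euclidean
  one, and \<open>*s\<close> is multiplication by complex scalars. All the holomorphy notions below are only
  used on open sets, so the full filter \<open>at z\<close> is the appropriate one.
\<close>

text \<open>Complex differentiability: the real Frechet derivative exists and is complex linear.\<close>

definition holomorphic_fun_on :: "(complex ^ 'n \<Rightarrow> complex) \<Rightarrow> (complex ^ 'n) set \<Rightarrow> bool" where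
  "holomorphic_fun_on f S \<longleftrightarrow>
     (\<forall>z\<in>S. \<exists>L. (f has_derivative L) (at z) \<and> (\<forall>c v. L (c *s v) = c * L v))"

definition holomorphic_map_on ::
    "(complex ^ 'n \<Rightarrow> complex ^ 'm) \<Rightarrow> (complex ^ 'n) set \<Rightarrow> bool" where
  "holomorphic_map_on F S \<longleftrightarrow> (\<forall>i. holomorphic_fun_on (\<lambda>z. F z $ i) S)"

definition biholomorphic_onto ::
    "(complex ^ 'n \<Rightarrow> complex ^ 'n) \<Rightarrow> (complex ^ 'n) set \<Rightarrow> (complex ^ 'n) set \<Rightarrow> bool" where
  "biholomorphic_onto F S T \<longleftrightarrow>
     bij_betw F S T \<and> holomorphic_map_on F S \<and> holomorphic_map_on (inv_into S F) T"

definition holomorphic_automorphism :: "(complex ^ 'n \<Rightarrow> complex ^ 'n) \<Rightarrow> bool" where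
  "holomorphic_automorphism \<Phi> \<longleftrightarrow> biholomorphic_onto \<Phi> UNIV UNIV"

definition is_domain :: "(complex ^ 'n) set \<Rightarrow> bool" where
  "is_domain D \<longleftrightarrow> open D \<and> connected D \<and> D \<noteq> {}"

text \<open>A polynomial function is a finite linear combination of monomials; the multi-indices
  are the functions \<open>\<alpha> :: 'n \<Rightarrow> nat\<close>.\<close>

definition polynomial_fun :: "(complex ^ 'n \<Rightarrow> complex) \<Rightarrow> bool" where
  "polynomial_fun p \<longleftrightarrow>
     (\<exists>(A :: ('n \<Rightarrow> nat) set) c. finite A \<and>
        (\<forall>z. p z = (\<Sum>\<alpha>\<in>A. c \<alpha> * (\<Prod>i\<in>UNIV. (z $ i) ^ \<alpha> i))))"

definition runge_domain :: "(complex ^ 'n) set \<Rightarrow> bool" where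
  "runge_domain D \<longleftrightarrow> is_domain D \<and>
     (\<forall>f. holomorphic_fun_on f D \<longrightarrow>
        (\<forall>K e. compact K \<and> K \<subseteq> D \<and> e > 0 \<longrightarrow>
           (\<exists>p. polynomial_fun p \<and> (\<forall>z\<in>K. norm (p z - f z) < e))))"

text \<open>A flow is defined for all real times. Holomorphic fields are locally Lipschitz, so they have at
  most one flow in this sense.\<close>

definition is_flow ::
    "(complex ^ 'n \<Rightarrow> complex ^ 'n) \<Rightarrow> (real \<Rightarrow> complex ^ 'n \<Rightarrow> complex ^ 'n) \<Rightarrow> bool" where
  "is_flow V \<phi> \<longleftrightarrow>
     (\<forall>z. \<phi> 0 z = z \<and> (\<forall>t. ((\<lambda>s. \<phi> s z) has_vector_derivative V (\<phi> t z)) (at t)))"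

definition complete_holomorphic_field :: "(complex ^ 'n \<Rightarrow> complex ^ 'n) \<Rightarrow> bool" where
  "complete_holomorphic_field V \<longleftrightarrow> holomorphic_map_on V UNIV \<and> (\<exists>\<phi>. is_flow V \<phi>)"

definition globally_attracting_origin ::
    "(complex ^ 'n \<Rightarrow> complex ^ 'n) \<Rightarrow> (real \<Rightarrow> complex ^ 'n \<Rightarrow> complex ^ 'n) \<Rightarrow> bool" where
  "globally_attracting_origin V \<phi> \<longleftrightarrow>
     V 0 = 0 \<and>
     (\<forall>z. ((\<lambda>t. \<phi> t z) \<longlongrightarrow> 0) at_top) \<and>
     (\<forall>\<epsilon>>0. \<exists>\<delta>>0. \<forall>z\<in>ball 0 \<delta>. \<forall>t\<ge>0. \<phi> t z \<in> ball 0 \<epsilon>)"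

definition positively_invariant ::
    "(real \<Rightarrow> complex ^ 'n \<Rightarrow> complex ^ 'n) \<Rightarrow> (complex ^ 'n) set \<Rightarrow> bool" where
  "positively_invariant \<phi> \<Omega> \<longleftrightarrow> (\<forall>z\<in>\<Omega>. \<forall>t\<ge>0. \<phi> t z \<in> \<Omega>)"

end

theory Submission
  imports Defs "HOL-Complex_Analysis.Cauchy_Integral_Formula"
begin

text \<open>
  The map \<open>F\<close> is reached from \<open>F \<circ> \<phi> T\<close> by a flow. For \<open>z\<close> in the compact set \<open>K\<close> the curve
  \<open>t \<mapsto> F (\<phi> (T - t) z)\<close>, \<open>0 \<le> t \<le> T\<close>, stays in \<open>\<Omega>'\<close> because \<open>\<Omega>\<close> is positively invariant; it
  joins \<open>F (\<phi> T z)\<close> to \<open>F z\<close>, and it is a trajectory of the push-forward of \<open>- V\<close> under \<open>F\<close>, an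
  autonomous holomorphic field on all of \<open>\<Omega>'\<close>. Since \<open>\<Omega>'\<close> is Runge, this field is a limit of
  polynomial fields on compacts. Every polynomial field \<open>P\<close> on \<open>\<complex>\<^sup>n\<close>, \<open>n > 1\<close>, is generated by
  automorphisms: for small \<open>h > 0\<close> there are automorphisms \<open>S\<close> with \<open>S = id + h P + o(h)\<close> on
  compacts (\<open>automorphism_generated_polynomial\<close>, the idea of Andersen and Lempert). The iterates
  \<open>S \<circ> \<dots> \<circ> S\<close> then converge to the flow as an Euler scheme does (\<open>time_map_approximable\<close>),
  hence the map \<open>F (\<phi> T z) \<mapsto> F z\<close> is a limit of automorphisms on \<open>F (\<phi> T K)\<close>.

  It remains to approximate \<open>F \<circ> \<phi> T\<close> on \<open>K\<close>. The map \<open>\<phi> T\<close> is an automorphism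
  (\<open>flow_automorphism\<close>), and for large \<open>T\<close> it carries \<open>K\<close> into a small ball around \<open>0\<close>
  (\<open>uniform_attraction\<close>). On such a ball \<open>F\<close> itself is approximated by the same argument with
  the Euler field \<open>z \<mapsto> z\<close> in place of \<open>- V\<close> (\<open>approximable_near_origin\<close>): its push-forward is again holomorphic on
  all of \<open>\<Omega>'\<close>, and running it for a long time from the points \<open>F 0 + exp (- T) DF(0) z\<close> leads to
  points close to \<open>F z\<close>.

  Polynomial fields are reached through exponentials: shears and overshears give, in the limit, all
  fields \<open>exp (\<lambda>(z)) v\<close> with \<open>\<lambda>\<close> a linear form and \<open>v\<close> a vector, and difference quotients in
  \<open>\<lambda>\<close> at \<open>0\<close> turn exponentials into monomials. The facts about several complex variables behind all
  this are the Cauchy estimates on complex lines and two consequences: locally uniform limits of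
  holomorphic functions are holomorphic, and so are directional derivatives.
\<close>

section \<open>Euler schemes and Gronwall estimates\<close>

text \<open>
  Only a point of \<open>L\<close> and a nearby point are compared: this is what a function with a locally
  bounded derivative satisfies near a compact set \<open>L\<close> that need not be convex, and it suffices for
  comparing an exact trajectory in \<open>L\<close> with an approximate one.
\<close>

definition lipschitz_near :: "real \<Rightarrow> real \<Rightarrow> ('a::real_normed_vector \<Rightarrow> 'a) \<Rightarrow> 'a set \<Rightarrow> bool" where
  "lipschitz_near \<delta> \<Lambda> W L \<longleftrightarrow>
     (\<forall>y\<in>L. \<forall>x. norm (x - y) \<le> \<delta> \<longrightarrow> norm (W x - W y) \<le> \<Lambda> * norm (x - y))"

text \<open>
  The time-\<open>h\<close> map of the flow of \<open>W\<close> is \<open>id + h W + o(h)\<close>; the condition asks that \<open>\<A>\<close>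
  contain maps with this expansion, uniformly on \<open>C\<close>. It is used for the automorphisms and, to see
  that flows are holomorphic, for the entire maps.
\<close>

definition generated_by :: "('a::real_normed_vector \<Rightarrow> 'a) set \<Rightarrow> ('a \<Rightarrow> 'a) \<Rightarrow> 'a set \<Rightarrow> bool" where
  "generated_by \<A> W C \<longleftrightarrow>
     (\<forall>\<epsilon>>0. \<exists>h0>0. \<forall>h. 0 < h \<and> h \<le> h0 \<longrightarrow>
        (\<exists>S\<in>\<A>. \<forall>x\<in>C. norm (S x - (x + h *\<^sub>R W x)) \<le> \<epsilon> * h))"

lemma displacement_bound:
  fixes y :: "real \<Rightarrow> 'a::real_normed_vector"
  assumes y': "\<And>t. a \<le> t \<Longrightarrow> t \<le> b \<Longrightarrow> (y has_vector_derivative y' t) (at t)"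
    and B: "\<And>t. a \<le> t \<Longrightarrow> t \<le> b \<Longrightarrow> norm (y' t) \<le> B"
    and st: "a \<le> s" "s \<le> t" "t \<le> b"
  shows "norm (y t - y s) \<le> B * (t - s)"
proof -
  have "norm (y t - y s) \<le> B * norm (t - s)"
  proof (rule differentiable_bound[where S="{a..b}" and f'="\<lambda>t x. x *\<^sub>R y' t"])
    fix x assume x: "x \<in> {a..b}"
    show "(y has_derivative (\<lambda>xa. xa *\<^sub>R y' x)) (at x within {a..b})"
      using y'[of x] x by (auto simp: has_vector_derivative_def intro: has_derivative_at_withinI)
    show "onorm (\<lambda>xa. xa *\<^sub>R y' x) \<le> B"
      using B[of x] x by (intro onorm_le) (auto simp: mult.commute[of B] mult_left_mono)
  qed (use st in auto)
  then show ?thesis using st by simp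
qed

lemma euler_step_error:
  fixes y :: "real \<Rightarrow> 'a::real_normed_vector"
  assumes y': "\<And>t. a \<le> t \<Longrightarrow> t \<le> a + h \<Longrightarrow> (y has_vector_derivative W (y t)) (at t)"
    and yL: "\<And>t. a \<le> t \<Longrightarrow> t \<le> a + h \<Longrightarrow> y t \<in> L"
    and lip: "lipschitz_near \<delta> \<Lambda> W L"
    and M: "\<And>x. x \<in> L \<Longrightarrow> norm (W x) \<le> M"
    and h: "0 < h" "M * h \<le> \<delta>" and \<Lambda>: "0 \<le> \<Lambda>"
  shows "norm (y (a + h) - (y a + h *\<^sub>R W (y a))) \<le> \<Lambda> * M * h * h"
proof -
  define d where "d t = y t - t *\<^sub>R W (y a)" for t
  have M0: "0 \<le> M" using order_trans[OF norm_ge_zero M[OF yL[of a]]] h by simp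
  have "norm (d (a + h) - d a) \<le> (\<Lambda> * M * h) * (a + h - a)"
  proof (rule displacement_bound[where y'="\<lambda>t. W (y t) - W (y a)"])
    fix t assume t: "a \<le> t" "t \<le> a + h"
    show "(d has_vector_derivative W (y t) - W (y a)) (at t)"
      unfolding d_def by (auto intro!: derivative_eq_intros y' t)
    have n: "norm (y t - y a) \<le> M * (t - a)"
      by (rule displacement_bound[OF y' M[OF yL]]) (use t h in auto)
    also have "\<dots> \<le> M * h" using t M0 by (intro mult_left_mono) auto
    finally have n': "norm (y t - y a) \<le> M * h" .
    then have "norm (W (y t) - W (y a)) \<le> \<Lambda> * norm (y t - y a)"
      using lip yL[of a] h unfolding lipschitz_near_def by auto
    also have "\<dots> \<le> \<Lambda> * (M * h)" using n' \<Lambda> by (intro mult_left_mono) auto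
    finally show "norm (W (y t) - W (y a)) \<le> \<Lambda> * M * h" by (simp add: mult.assoc)
  qed (use h in auto)
  then show ?thesis by (simp add: d_def algebra_simps)
qed

text \<open>
  The induction step of the bound \<open>k h \<kappa> (1 + h \<Lambda>)^k\<close> for an error that grows by the factor
  \<open>1 + h \<Lambda>\<close> and by the amount \<open>h \<kappa>\<close> in each step.
\<close>

lemma discrete_gronwall_step:
  fixes e :: real
  assumes "e \<le> real k * h * \<kappa> * (1 + h * \<Lambda>) ^ k" "0 \<le> h" "0 \<le> \<kappa>" "0 \<le> \<Lambda>"
  shows "(1 + h * \<Lambda>) * e + h * \<kappa> \<le> real (Suc k) * h * \<kappa> * (1 + h * \<Lambda>) ^ Suc k"
proof -
  have "(1 + h * \<Lambda>) * e \<le> (1 + h * \<Lambda>) * (real k * h * \<kappa> * (1 + h * \<Lambda>) ^ k)"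
    using assms by (intro mult_left_mono) auto
  moreover have "h * \<kappa> * 1 \<le> h * \<kappa> * (1 + h * \<Lambda>) ^ Suc k"
    using assms by (intro mult_left_mono one_le_power) auto
  ultimately show ?thesis by (simp add: algebra_simps)
qed

text \<open>
  This is the convergence of a consistent one-step method. If a single step of size \<open>h = T / N\<close> has
  error at most \<open>h \<kappa>\<close>, then the error at time \<open>T\<close> is at most \<open>T \<kappa> exp (\<Lambda> T)\<close>. Taking \<open>\<kappa>\<close> small makes
  this less than \<open>\<eta>\<close> and at most \<open>\<delta>\<close>, so that the iterates never leave the neighbourhood of
  \<open>L\<close> where the step maps and the Lipschitz bound are under control. The parameter \<open>p\<close> labels
  the trajectories, since one and the same map has to work for all of them.
\<close>

lemma time_map_approximable:
  fixes W :: "'a::real_normed_vector \<Rightarrow> 'a" and y :: "'p \<Rightarrow> real \<Rightarrow> 'a"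
  assumes idA: "id \<in> \<A>" and compA: "\<And>f g. f \<in> \<A> \<Longrightarrow> g \<in> \<A> \<Longrightarrow> f \<circ> g \<in> \<A>"
    and gen: "generated_by \<A> W {x. \<exists>z\<in>L. norm (x - z) \<le> \<delta>}"
    and lip: "lipschitz_near \<delta> \<Lambda> W L" and \<delta>: "0 < \<delta>" and \<Lambda>: "0 \<le> \<Lambda>"
    and M: "\<And>x. x \<in> L \<Longrightarrow> norm (W x) \<le> M"
    and T: "0 \<le> T"
    and y': "\<And>p t. p \<in> P \<Longrightarrow> 0 \<le> t \<Longrightarrow> t \<le> T \<Longrightarrow> (y p has_vector_derivative W (y p t)) (at t)"
    and yL: "\<And>p t. p \<in> P \<Longrightarrow> 0 \<le> t \<Longrightarrow> t \<le> T \<Longrightarrow> y p t \<in> L"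
    and \<eta>: "0 < \<eta>"
  shows "\<exists>\<Phi>\<in>\<A>. \<forall>p\<in>P. norm (\<Phi> (y p 0) - y p T) < \<eta>"
proof (cases "P = {} \<or> T = 0")
  case True
  then show ?thesis using idA \<eta> by (intro bexI[of _ id]) auto
next
  case False
  then have T0: "0 < T" using T by auto
  obtain p0 where "p0 \<in> P" using False by auto
  then have M0: "0 \<le> M" using order_trans[OF norm_ge_zero M[OF yL[of p0 0]]] T by simp
  \<comment> \<open>the error per unit of time that is affordable: \<open>T \<kappa> exp (\<Lambda> T)\<close> has to be at most \<open>\<delta>\<close> and \<open>\<eta>/2\<close>\<close>
  define \<kappa> where "\<kappa> = min \<delta> (\<eta>/2) / (T * exp (\<Lambda> * T))"
  have \<kappa>: "0 < \<kappa>" using \<delta> \<eta> T0 by (simp add: \<kappa>_def)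
  have "0 < \<kappa> / 2" using \<kappa> by simp
  then obtain h0 where h0: "0 < h0"
    and S_ex: "\<forall>h. 0 < h \<and> h \<le> h0 \<longrightarrow> (\<exists>S\<in>\<A>. \<forall>x\<in>{x. \<exists>z\<in>L. norm (x - z) \<le> \<delta>}.
           norm (S x - (x + h *\<^sub>R W x)) \<le> \<kappa> / 2 * h)"
    using gen unfolding generated_by_def by (elim allE[of _ "\<kappa> / 2"]) auto
  \<comment> \<open>\<open>h B < 1\<close> collects the three smallness conditions on the step size: \<open>h \<le> h0\<close>, \<open>M h \<le> \<delta>\<close> and \<open>\<Lambda> M h \<le> \<kappa>/2\<close>\<close>
  define B where "B = 1/h0 + M/\<delta> + 2*\<Lambda>*M/\<kappa>"
  obtain N where N: "T * B < real N" using reals_Archimedean2 by blast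
  have B0: "0 < B" using h0 M0 \<delta> \<Lambda> \<kappa> by (auto simp: B_def intro!: add_pos_nonneg)
  then have N0: "0 < real N" using N T0 by (meson less_trans mult_pos_pos)
  define h where "h = T / real N"
  have h: "0 < h" using T0 N0 by (simp add: h_def)
  have hB: "h * B < 1" using N N0 by (simp add: h_def field_simps)
  have hle: "h * c \<le> 1" if "c \<le> B" for c
    using hB that h by (meson less_eq_real_def mult_left_mono order_trans)
  have "h * (1/h0) \<le> 1" "h * (M/\<delta>) \<le> 1" "h * (2*\<Lambda>*M/\<kappa>) \<le> 1"
    using M0 h0 \<delta> \<Lambda> \<kappa> by (intro hle; simp add: B_def)+
  then have hh0: "h \<le> h0" and hM: "M * h \<le> \<delta>" and h\<kappa>: "\<Lambda> * M * h \<le> \<kappa> / 2"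
    using h0 \<delta> \<kappa> by (simp_all add: field_simps)
  obtain S where SA: "S \<in> \<A>" and S: "\<And>x z. z \<in> L \<Longrightarrow> norm (x - z) \<le> \<delta> \<Longrightarrow>
           norm (S x - (x + h *\<^sub>R W x)) \<le> \<kappa> / 2 * h"
    using S_ex h hh0 by blast
  have pow_le: "real k * h * \<kappa> * (1 + h * \<Lambda>) ^ k \<le> min \<delta> (\<eta>/2)" if "k \<le> N" for k
  proof -
    have "(1 + h * \<Lambda>) ^ k \<le> exp (h * \<Lambda>) ^ k"
      using h \<Lambda> by (intro power_mono) (auto simp: exp_ge_add_one_self add.commute)
    also have "\<dots> = exp (real k * (h * \<Lambda>))" by (simp add: exp_of_nat_mult)
    also have kh: "real k * h \<le> T" using that h N0 by (simp add: h_def field_simps)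
    then have "exp (real k * (h * \<Lambda>)) \<le> exp (\<Lambda> * T)"
      using mult_right_mono[OF kh \<Lambda>] by (simp add: mult_ac)
    finally have "real k * h * \<kappa> * (1 + h * \<Lambda>) ^ k \<le> T * \<kappa> * exp (\<Lambda> * T)"
      using kh h \<Lambda> \<kappa> T by (intro mult_mono) auto
    also have "\<dots> = min \<delta> (\<eta>/2)" using T0 by (simp add: \<kappa>_def)
    finally show ?thesis .
  qed
  have iterA: "(S ^^ k) \<in> \<A>" for k
  proof (induction k)
    case (Suc k)
    then show ?case using compA[OF SA Suc] by (simp only: funpow.simps)
  qed (simp only: funpow.simps idA)
  have err: "norm ((S ^^ k) (y p 0) - y p (real k * h)) \<le> real k * h * \<kappa> * (1 + h * \<Lambda>) ^ k"
    if "k \<le> N" "p \<in> P" for k p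
    using that(1)
  proof (induction k)
    case (Suc k)
    define t where "t = real k * h"
    define x where "x = (S ^^ k) (y p 0)"
    have th: "0 \<le> t" "t + h \<le> T"
      using Suc.prems h N0 mult_right_mono[of "1 + real k" "real N" h]
      by (auto simp: t_def h_def field_simps)
    have IH: "norm (x - y p t) \<le> real k * h * \<kappa> * (1 + h * \<Lambda>) ^ k"
      using Suc by (simp add: x_def t_def)
    have yt: "y p t \<in> L" using that th h by (intro yL) auto
    have x\<delta>: "norm (x - y p t) \<le> \<delta>" using IH pow_le[of k] Suc.prems by simp
    have lipx: "norm (W x - W (y p t)) \<le> \<Lambda> * norm (x - y p t)"
      using lip yt x\<delta> unfolding lipschitz_near_def by auto
    have "norm (y p (t + h) - (y p t + h *\<^sub>R W (y p t))) \<le> \<Lambda> * M * h * h"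
      by (rule euler_step_error[OF _ _ lip M h hM \<Lambda>]) (use that th in \<open>auto intro: y' yL\<close>)
    also have "\<dots> \<le> \<kappa> / 2 * h" using h\<kappa> h by (intro mult_right_mono) auto
    finally have e1: "norm (y p (t + h) - (y p t + h *\<^sub>R W (y p t))) \<le> \<kappa> / 2 * h" .
    have e2: "norm (S x - (x + h *\<^sub>R W x)) \<le> \<kappa> / 2 * h" by (rule S[OF yt x\<delta>])
    have e3: "norm (h *\<^sub>R (W x - W (y p t))) \<le> h * (\<Lambda> * norm (x - y p t))"
      using lipx h by simp
    have "S x - y p (t + h) = (S x - (x + h *\<^sub>R W x)) + (x - y p t) + h *\<^sub>R (W x - W (y p t))
             - (y p (t + h) - (y p t + h *\<^sub>R W (y p t)))"
      by (simp add: algebra_simps)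
    also have "norm \<dots> \<le> \<kappa> / 2 * h + norm (x - y p t) + h * (\<Lambda> * norm (x - y p t)) + \<kappa> / 2 * h"
      using norm_triangle_le_diff norm_triangle_mono[OF norm_triangle_mono[OF e2 order_refl] e3]
        order_trans[OF norm_triangle_ineq4 add_mono[OF _ e1]] by blast
    also have "\<dots> = (1 + h * \<Lambda>) * norm (x - y p t) + h * \<kappa>" by (simp add: algebra_simps)
    also have "\<dots> \<le> real (Suc k) * h * \<kappa> * (1 + h * \<Lambda>) ^ Suc k"
      by (rule discrete_gronwall_step[OF IH]) (use h \<kappa> \<Lambda> in auto)
    finally show ?case by (simp add: x_def t_def algebra_simps)
  qed simp
  have "norm ((S ^^ N) (y p 0) - y p T) < \<eta>" if "p \<in> P" for p
    using err[of N p] pow_le[of N] that N0 \<eta> by (simp add: h_def)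
  then show ?thesis using iterA[of N] by blast
qed

text \<open>
  Of the two solutions only \<open>z\<close> is assumed to lie in \<open>L\<close>; \<open>y\<close> is not known to stay near \<open>L\<close>: this follows from a continuity argument,
  because the bound is smaller than \<open>\<delta>\<close> as long as it holds. With \<open>y 0 = z 0\<close> this gives uniqueness of
  solutions, otherwise continuous dependence on the initial value.
\<close>

lemma gronwall_nearby_solution:
  fixes y z :: "real \<Rightarrow> 'a::real_inner"
  assumes y': "\<And>t. 0 \<le> t \<Longrightarrow> t \<le> T \<Longrightarrow> (y has_vector_derivative W (y t)) (at t)"
    and z': "\<And>t. 0 \<le> t \<Longrightarrow> t \<le> T \<Longrightarrow> (z has_vector_derivative W (z t)) (at t)"
    and zL: "\<And>t. 0 \<le> t \<Longrightarrow> t \<le> T \<Longrightarrow> z t \<in> L"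
    and lip: "lipschitz_near \<delta> \<Lambda> W L" and \<Lambda>: "0 \<le> \<Lambda>"
    and close: "norm (y 0 - z 0) * exp (\<Lambda> * T) < \<delta>"
    and t: "0 \<le> t" "t \<le> T"
  shows "norm (y t - z t) \<le> norm (y 0 - z 0) * exp (\<Lambda> * t)"
proof -
  define d where "d t = y t - z t" for t
  have d': "(d has_vector_derivative W (y t) - W (z t)) (at t)" if "0 \<le> t" "t \<le> T" for t
    unfolding d_def using y' z' that by (auto intro!: derivative_eq_intros)
  \<comment> \<open>As long as the two solutions stay within \<open>\<delta>\<close>, the weighted square of the distance decreases.\<close>
  have step: "norm (d b) \<le> norm (d 0) * exp (\<Lambda> * b)"
    if b: "0 \<le> b" "b \<le> T" and st: "\<And>s. 0 \<le> s \<Longrightarrow> s \<le> b \<Longrightarrow> norm (d s) \<le> \<delta>" for b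
  proof -
    define u where "u t = (d t \<bullet> d t) * exp (- 2 * \<Lambda> * t)" for t
    have "u b \<le> u 0"
    proof (rule DERIV_nonpos_imp_nonincreasing[OF b(1)])
      fix s assume s: "0 \<le> s" "s \<le> b"
      have dd: "((\<lambda>t. d t \<bullet> d t) has_real_derivative 2 * (d s \<bullet> (W (y s) - W (z s)))) (at s)"
        using d'[of s] s b unfolding has_vector_derivative_def has_field_derivative_def
        by (auto intro!: derivative_eq_intros simp: inner_commute algebra_simps fun_eq_iff)
      have "(u has_real_derivative
          (2 * (d s \<bullet> (W (y s) - W (z s))) - 2 * \<Lambda> * (d s \<bullet> d s)) * exp (- 2 * \<Lambda> * s)) (at s)"
        unfolding u_def by (auto intro!: derivative_eq_intros dd simp: algebra_simps)
      moreover have "d s \<bullet> (W (y s) - W (z s)) \<le> \<Lambda> * (d s \<bullet> d s)"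
      proof -
        have "d s \<bullet> (W (y s) - W (z s)) \<le> norm (d s) * norm (W (y s) - W (z s))"
          by (rule norm_cauchy_schwarz)
        also have "\<dots> \<le> norm (d s) * (\<Lambda> * norm (d s))"
          using lip zL[of s] st[of s] s b unfolding lipschitz_near_def d_def
          by (intro mult_left_mono) auto
        finally show ?thesis by (simp add: dot_square_norm power2_eq_square algebra_simps)
      qed
      ultimately show "\<exists>y. (u has_real_derivative y) (at s) \<and> y \<le> 0"
        by (auto intro!: exI mult_nonpos_nonneg)
    qed
    then have "(norm (d b))\<^sup>2 * exp (- 2 * \<Lambda> * b) \<le> (norm (d 0))\<^sup>2"
      by (simp add: u_def dot_square_norm)
    then have "(norm (d b))\<^sup>2 \<le> (norm (d 0))\<^sup>2 * exp (2 * \<Lambda> * b)"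
      by (simp add: exp_minus field_simps)
    also have "\<dots> = (norm (d 0) * exp (\<Lambda> * b))\<^sup>2"
      by (simp add: power_mult_distrib exp_double[symmetric] mult.assoc)
    finally show ?thesis by (rule power2_le_imp_le) simp
  qed
  have cont: "continuous_on {0..T} (\<lambda>s. norm (d s))"
    using has_vector_derivative_continuous[OF d']
    by (intro continuous_on_norm continuous_at_imp_continuous_on) auto
  have "norm (d s) < \<delta>" if s: "0 \<le> s" "s \<le> T" for s
  proof (rule ccontr)
    assume neg: "\<not> norm (d s) < \<delta>"
    \<comment> \<open>the times at which the distance is at least \<open>\<delta>\<close>; the first of them cannot exist by \<open>step\<close>\<close>
    define Z where "Z = {0..T} \<inter> (\<lambda>s. norm (d s)) -` {\<delta>..}"
    have Zc: "compact Z"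
      unfolding Z_def using cont
      by (metis closed_atLeast closed_atLeastAtMost compact_Icc compact_Int_closed
          continuous_on_closed_vimage inf.left_idem inf_commute)
    have "s \<in> Z" using s neg by (auto simp: Z_def)
    then obtain b where b: "b \<in> Z" and least: "\<And>r. r \<in> Z \<Longrightarrow> b \<le> r"
      using compact_attains_inf[OF Zc] by auto
    have bT: "0 \<le> b" "b \<le> T" "\<delta> \<le> norm (d b)" using b by (auto simp: Z_def)
    have d0: "norm (d 0) < \<delta>"
      using close \<Lambda> bT mult_left_mono[of 1 "exp (\<Lambda> * T)" "norm (d 0)"] by (simp add: d_def)
    have below: "norm (d r) < \<delta>" if "0 \<le> r" "r < b" for r
      using least[of r] that bT by (force simp: Z_def)
    have "norm (d b) \<le> \<delta>"
    proof (cases "b = 0")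
      case False
      have "continuous_on {0..b} (\<lambda>s. norm (d s))"
        by (rule continuous_on_subset[OF cont]) (use bT in auto)
      then have c: "continuous_on (closure {0<..<b}) (\<lambda>s. norm (d s))" using False bT by simp
      show ?thesis
        by (rule continuous_le_on_closure[OF c]) (use False bT below in \<open>auto intro: less_imp_le\<close>)
    qed (use d0 in auto)
    then have "norm (d b) \<le> norm (d 0) * exp (\<Lambda> * b)"
      using bT below by (intro step) (auto simp: le_less)
    also have "\<dots> \<le> norm (d 0) * exp (\<Lambda> * T)" using bT \<Lambda> by (simp add: mult_left_mono)
    also have "\<dots> < \<delta>" using close by (simp add: d_def)
    finally show False using bT by simp
  qed
  then have "norm (d t) \<le> norm (d 0) * exp (\<Lambda> * t)" using t by (intro step) (auto intro: less_imp_le)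
  then show ?thesis by (simp add: d_def)
qed

section \<open>Holomorphic maps of several variables\<close>

lemma norm_cscale: "norm (c *s v) = cmod c * norm v" for v :: "complex ^ 'n"
  by (simp add: norm_vec_def norm_mult L2_set_right_distrib)

lemma norm_vec_le_sum: "norm v \<le> (\<Sum>i\<in>UNIV. cmod (v $ i))" for v :: "complex ^ 'n"
  unfolding norm_vec_def by (rule L2_set_le_sum) auto

lemma bounded_linear_cscale_left: "bounded_linear (\<lambda>c. c *s v)" for v :: "complex ^ 'n"
  by (rule bounded_linear_intro[where K="norm v"])
    (auto simp: norm_cscale vec_eq_iff algebra_simps)

lemma bounded_linear_axis: "bounded_linear (\<lambda>c::complex. axis i c :: complex ^ 'n)"
  by (rule bounded_linear_intro[where K=1])
    (auto simp: axis_def vec_eq_iff norm_vec_def L2_set_def if_distrib[of "\<lambda>x. x\<^sup>2"] if_distrib[of cmod] cong: if_cong)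

lemma sum_axis_components: "(\<Sum>i\<in>UNIV. axis i (v $ i)) = v" for v :: "complex ^ 'n"
  by (auto simp: vec_eq_iff axis_def)

lemma closed_neighbourhood_eq_sums:
  "{x. \<exists>z\<in>L. norm (x - z) \<le> \<delta>} = {z + u |z u. z \<in> L \<and> u \<in> cball 0 \<delta>}"
  for L :: "'a::real_normed_vector set"
proof (intro set_eqI iffI)
  fix x assume "x \<in> {x. \<exists>z\<in>L. norm (x - z) \<le> \<delta>}"
  then obtain z where "z \<in> L" "norm (x - z) \<le> \<delta>" by auto
  then show "x \<in> {z + u |z u. z \<in> L \<and> u \<in> cball 0 \<delta>}"
    by (intro CollectI exI[of _ z] exI[of _ "x - z"]) auto
next
  fix x assume "x \<in> {z + u |z u. z \<in> L \<and> u \<in> cball 0 \<delta>}"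
  then obtain z u where "x = z + u" "z \<in> L" "norm u \<le> \<delta>" by auto
  then show "x \<in> {x. \<exists>z\<in>L. norm (x - z) \<le> \<delta>}" by (intro CollectI bexI[of _ z]) auto
qed

lemma compact_closed_neighbourhood:
  "compact L \<Longrightarrow> compact {x. \<exists>z\<in>L. norm (x - z) \<le> \<delta>}" for L :: "'a::euclidean_space set"
  unfolding closed_neighbourhood_eq_sums by (intro compact_sums) auto

lemma closed_neighbourhood_in_open:
  fixes L :: "'a::euclidean_space set"
  assumes "compact L" "open S" "L \<subseteq> S"
  obtains \<delta> where "0 < \<delta>" "{x. \<exists>z\<in>L. norm (x - z) \<le> \<delta>} \<subseteq> S"
proof -
  obtain \<delta> where "0 < \<delta>" "(\<Union>x\<in>L. cball x \<delta>) \<subseteq> S"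
    using compact_subset_open_imp_cball_epsilon_subset[OF assms] by blast
  then show thesis
    by (intro that[of \<delta>]) (auto simp: subset_iff dist_norm norm_minus_commute)
qed

text \<open>
  Differentiability of a map, with complex linear derivative, can be tested on components; this makes
  the chain rule for maps available.
\<close>

lemma holomorphic_map_on_iff:
  "holomorphic_map_on F S \<longleftrightarrow>
     (\<forall>z\<in>S. \<exists>L. (F has_derivative L) (at z) \<and> (\<forall>c v. L (c *s v) = c *s L v))"
proof (intro iffI ballI)
  fix z assume F: "holomorphic_map_on F S" and z: "z \<in> S"
  then have "\<forall>i. \<exists>L. ((\<lambda>z. F z $ i) has_derivative L) (at z) \<and> (\<forall>c v. L (c *s v) = c * L v)"
    unfolding holomorphic_map_on_def holomorphic_fun_on_def by blast
  then obtain L where L: "\<And>i. ((\<lambda>z. F z $ i) has_derivative L i) (at z)"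
    and lin: "\<And>i c v. L i (c *s v) = c * L i v" by metis
  have "((\<lambda>z. \<Sum>i\<in>UNIV. axis i (F z $ i)) has_derivative (\<lambda>v. \<Sum>i\<in>UNIV. axis i (L i v))) (at z)"
    by (intro has_derivative_sum bounded_linear.has_derivative[OF bounded_linear_axis] L)
  then have "(F has_derivative (\<lambda>v. \<Sum>i\<in>UNIV. axis i (L i v))) (at z)"
    by (simp add: sum_axis_components)
  moreover have "(\<Sum>i\<in>UNIV. axis i (L i (c *s v))) = c *s (\<Sum>i\<in>UNIV. axis i (L i v))" for c v
    by (auto simp: vec_eq_iff axis_def lin)
  ultimately show "\<exists>L. (F has_derivative L) (at z) \<and> (\<forall>c v. L (c *s v) = c *s L v)" by blast
next
  assume F: "\<forall>z\<in>S. \<exists>L. (F has_derivative L) (at z) \<and> (\<forall>c v. L (c *s v) = c *s L v)"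
  show "holomorphic_map_on F S"
    unfolding holomorphic_map_on_def holomorphic_fun_on_def
  proof (intro allI ballI)
    fix i z assume "z \<in> S"
    then obtain L where "(F has_derivative L) (at z)" "\<And>c v. L (c *s v) = c *s L v"
      using F by blast
    then show "\<exists>L. ((\<lambda>z. F z $ i) has_derivative L) (at z) \<and> (\<forall>c v. L (c *s v) = c * L v)"
      by (intro exI[of _ "\<lambda>v. L v $ i"])
        (auto intro: bounded_linear.has_derivative[OF bounded_linear_vec_nth])
  qed
qed

lemma holomorphic_fun_on_subset: "holomorphic_fun_on f S \<Longrightarrow> T \<subseteq> S \<Longrightarrow> holomorphic_fun_on f T"
  unfolding holomorphic_fun_on_def by blast

lemma holomorphic_map_on_subset: "holomorphic_map_on f S \<Longrightarrow> T \<subseteq> S \<Longrightarrow> holomorphic_map_on f T"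
  unfolding holomorphic_map_on_iff by blast

lemma holomorphic_fun_on_continuous: "holomorphic_fun_on f S \<Longrightarrow> continuous_on S f"
  unfolding holomorphic_fun_on_def
  by (metis continuous_at_imp_continuous_on has_derivative_continuous)

lemma holomorphic_map_on_continuous: "holomorphic_map_on f S \<Longrightarrow> continuous_on S f"
  unfolding holomorphic_map_on_iff
  by (metis continuous_at_imp_continuous_on has_derivative_continuous)

lemma holomorphic_fun_compose:
  assumes f: "holomorphic_fun_on f T" and G: "holomorphic_map_on G S" and sub: "\<And>z. z \<in> S \<Longrightarrow> G z \<in> T"
  shows "holomorphic_fun_on (\<lambda>z. f (G z)) S"
  unfolding holomorphic_fun_on_def
proof
  fix z assume z: "z \<in> S"
  obtain A where A: "(G has_derivative A) (at z)" "\<And>c v. A (c *s v) = c *s A v"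
    using G z unfolding holomorphic_map_on_iff by blast
  obtain L where L: "(f has_derivative L) (at (G z))" "\<And>c v. L (c *s v) = c * L v"
    using f sub[OF z] unfolding holomorphic_fun_on_def by blast
  show "\<exists>L. ((\<lambda>z. f (G z)) has_derivative L) (at z) \<and> (\<forall>c v. L (c *s v) = c * L v)"
    using has_derivative_compose[OF A(1) L(1)] A(2) L(2) by auto
qed

lemma holomorphic_map_compose:
  assumes "holomorphic_map_on F T" "holomorphic_map_on G S" "\<And>z. z \<in> S \<Longrightarrow> G z \<in> T"
  shows "holomorphic_map_on (\<lambda>z. F (G z)) S"
  using assms unfolding holomorphic_map_on_def[of F] holomorphic_map_on_def[of "\<lambda>z. F (G z)"]
  by (auto intro: holomorphic_fun_compose)

lemma holomorphic_fun_const: "holomorphic_fun_on (\<lambda>z. c) S"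
  unfolding holomorphic_fun_on_def by (auto intro!: exI[of _ "\<lambda>_. 0"])

lemma holomorphic_fun_linear:
  assumes "bounded_linear L" "\<And>c v. L (c *s v) = c * L v"
  shows "holomorphic_fun_on L S"
  unfolding holomorphic_fun_on_def
  using bounded_linear_imp_has_derivative[OF assms(1)] assms(2) by blast

lemma holomorphic_fun_add:
  assumes "holomorphic_fun_on f S" "holomorphic_fun_on g S"
  shows "holomorphic_fun_on (\<lambda>z. f z + g z) S"
  unfolding holomorphic_fun_on_def
proof
  fix z assume "z \<in> S"
  then obtain A B where "(f has_derivative A) (at z)" "(g has_derivative B) (at z)"
    "\<And>c v. A (c *s v) = c * A v" "\<And>c v. B (c *s v) = c * B v"
    using assms unfolding holomorphic_fun_on_def by metis
  then show "\<exists>L. ((\<lambda>z. f z + g z) has_derivative L) (at z) \<and> (\<forall>c v. L (c *s v) = c * L v)"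
    by (intro exI[of _ "\<lambda>v. A v + B v"]) (auto intro: has_derivative_add simp: algebra_simps)
qed

lemma holomorphic_fun_mult:
  assumes "holomorphic_fun_on f S" "holomorphic_fun_on g S"
  shows "holomorphic_fun_on (\<lambda>z. f z * g z) S"
  unfolding holomorphic_fun_on_def
proof
  fix z assume "z \<in> S"
  then obtain A B where A: "(f has_derivative A) (at z)" "\<And>c v. A (c *s v) = c * A v"
    and B: "(g has_derivative B) (at z)" "\<And>c v. B (c *s v) = c * B v"
    using assms unfolding holomorphic_fun_on_def by metis
  show "\<exists>L. ((\<lambda>z. f z * g z) has_derivative L) (at z) \<and> (\<forall>c v. L (c *s v) = c * L v)"
    using has_derivative_mult[OF A(1) B(1)] by (intro exI conjI) (assumption, simp add: A(2) B(2) algebra_simps)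
qed

lemma holomorphic_fun_diff:
  assumes "holomorphic_fun_on f S" "holomorphic_fun_on g S"
  shows "holomorphic_fun_on (\<lambda>z. f z - g z) S"
  using holomorphic_fun_add[OF assms(1) holomorphic_fun_mult[OF holomorphic_fun_const[of "-1"] assms(2)]]
  by simp

lemma holomorphic_fun_exp:
  assumes "holomorphic_fun_on f S"
  shows "holomorphic_fun_on (\<lambda>z. exp (f z)) S"
  unfolding holomorphic_fun_on_def
proof
  fix z assume "z \<in> S"
  then obtain A where A: "(f has_derivative A) (at z)" "\<And>c v. A (c *s v) = c * A v"
    using assms unfolding holomorphic_fun_on_def by metis
  have "(exp has_derivative (*) (exp (f z))) (at (f z))"
    using DERIV_exp[of "f z"] by (simp add: has_field_derivative_def)
  from has_derivative_compose[OF A(1) this] A(2)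
  show "\<exists>L. ((\<lambda>z. exp (f z)) has_derivative L) (at z) \<and> (\<forall>c v. L (c *s v) = c * L v)"
    by (intro exI[of _ "\<lambda>v. exp (f z) * A v"]) (auto simp: algebra_simps)
qed

lemma holomorphic_map_const: "holomorphic_map_on (\<lambda>z. c) S"
  by (simp add: holomorphic_map_on_def holomorphic_fun_const)

lemma holomorphic_fun_component: "holomorphic_fun_on (\<lambda>z. z $ i) S"
  by (rule holomorphic_fun_linear) (auto intro: bounded_linear_vec_nth)

lemma holomorphic_map_id: "holomorphic_map_on (\<lambda>z. z) S"
  by (simp add: holomorphic_map_on_def holomorphic_fun_component)

lemma holomorphic_map_add:
  "holomorphic_map_on F S \<Longrightarrow> holomorphic_map_on G S \<Longrightarrow> holomorphic_map_on (\<lambda>z. F z + G z) S"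
  by (simp add: holomorphic_map_on_def holomorphic_fun_add)

lemma holomorphic_map_cscale:
  "holomorphic_fun_on f S \<Longrightarrow> holomorphic_map_on F S \<Longrightarrow> holomorphic_map_on (\<lambda>z. f z *s F z) S"
  by (simp add: holomorphic_map_on_def holomorphic_fun_mult)

lemma scaleR_eq_cscale: "r *\<^sub>R v = of_real r *s v" for v :: "complex ^ 'n"
  by (simp add: vec_eq_iff scaleR_conv_of_real[where 'a=complex])

lemma holomorphic_map_scaleR:
  "holomorphic_map_on F S \<Longrightarrow> holomorphic_map_on (\<lambda>z. r *\<^sub>R F z) S"
  unfolding scaleR_eq_cscale by (intro holomorphic_map_cscale holomorphic_fun_const)

lemma holomorphic_map_linear:
  assumes "bounded_linear A" "\<And>c v. A (c *s v) = c *s A v"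
  shows "holomorphic_map_on A S"
  unfolding holomorphic_map_on_iff
  using bounded_linear_imp_has_derivative[OF assms(1)] assms(2) by blast

lemma slice_has_field_derivative:
  fixes f :: "complex ^ 'n \<Rightarrow> complex"
  assumes L: "(f has_derivative L) (at (z + \<zeta> *s v))" "\<And>c v. L (c *s v) = c * L v"
  shows "((\<lambda>\<zeta>. f (z + \<zeta> *s v)) has_field_derivative L v) (at \<zeta>)"
proof -
  have "((\<lambda>\<zeta>. z + \<zeta> *s v) has_derivative (\<lambda>\<zeta>. \<zeta> *s v)) (at \<zeta>)"
    using has_derivative_add[OF has_derivative_const[of z]
        bounded_linear_imp_has_derivative[OF bounded_linear_cscale_left[of v]]] by simp
  from has_derivative_compose[OF this L(1)] show ?thesis
    by (simp add: has_field_derivative_def L(2) mult_commute_abs)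
qed

text \<open>
  Both estimates come from the one-variable Cauchy inequalities on the complex line through \<open>z\<close> in
  the direction \<open>v\<close>. The second one bounds the Taylor remainder by the second derivative along this line,
  which is at most \<open>2 M / (r/2)\<^sup>2\<close> at distance at most \<open>r/2\<close> from \<open>z\<close>.
\<close>

lemma cauchy_estimates:
  fixes f :: "complex ^ 'n \<Rightarrow> complex"
  assumes hol: "holomorphic_fun_on f S" and S: "open S" and sub: "cball z r \<subseteq> S" and r: "0 < r"
    and M: "\<And>x. x \<in> cball z r \<Longrightarrow> cmod (f x) \<le> M"
    and L: "(f has_derivative L) (at z)" "\<And>c v. L (c *s v) = c * L v"
  shows cauchy_first_order: "cmod (L v) \<le> M / r * norm v"
    and cauchy_second_order:
      "norm v \<le> r / 2 \<Longrightarrow> cmod (f (z + v) - f z - L v) \<le> 8 * M / r\<^sup>2 * (norm v)\<^sup>2"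
proof -
  \<comment> \<open>for \<open>v = 0\<close> this is \<open>u = 0\<close>, and the line degenerates to the point \<open>z\<close>\<close>
  define u where "u = of_real (1 / norm v) *s v"
  define g where "g \<zeta> = f (z + \<zeta> *s u)" for \<zeta>
  define U where "U = (\<lambda>\<zeta>. z + \<zeta> *s u) -` S"
  have nu: "norm u \<le> 1" by (simp add: u_def norm_cscale norm_divide)
  have vu: "v = of_real (norm v) *s u" by (simp add: u_def vector_scalar_mult_def vec_eq_iff)
  have "continuous_on UNIV (\<lambda>\<zeta>. z + \<zeta> *s u)"
    by (intro continuous_intros linear_continuous_on bounded_linear_cscale_left)
  then have U: "open U" unfolding U_def using S open_vimage by blast
  have in_ball: "z + \<zeta> *s u \<in> cball z r" if "cmod \<zeta> \<le> r" for \<zeta>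
    using that mult_mono[of "cmod \<zeta>" r "norm u" 1] nu r by (simp add: dist_norm norm_cscale)
  have rU: "cball 0 r \<subseteq> U"
  proof
    fix \<zeta> :: complex assume "\<zeta> \<in> cball 0 r"
    then have "z + \<zeta> *s u \<in> S" using in_ball[of \<zeta>] sub unfolding mem_cball_0 by blast
    then show "\<zeta> \<in> U" by (simp add: U_def)
  qed
  have g': "\<exists>d. (g has_field_derivative d) (at \<zeta>)" if "\<zeta> \<in> U" for \<zeta>
    using hol that slice_has_field_derivative unfolding g_def U_def holomorphic_fun_on_def vimage_eq
    by metis
  then have gU: "g holomorphic_on U" using U holomorphic_on_open by blast
  have M0: "0 \<le> M" using order_trans[OF norm_ge_zero M[of z]] r by simp
  have g0: "(g has_field_derivative L u) (at 0)"
    unfolding g_def by (rule slice_has_field_derivative) (use L in auto)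
  then have dg0: "deriv g 0 = L u" by (rule DERIV_imp_deriv)
  have Lv: "L v = of_real (norm v) * L u" using L(2)[of "of_real (norm v)" u] vu by metis
  have est: "cmod ((deriv ^^ n) g \<xi>) \<le> fact n * M / \<rho> ^ n" if "cmod \<xi> + \<rho> \<le> r" "0 < \<rho>" for n \<xi> \<rho>
  proof (rule Cauchy_inequality)
    have in_r: "x \<in> cball 0 r" if "x \<in> cball \<xi> \<rho>" for x
      using that \<open>cmod \<xi> + \<rho> \<le> r\<close> norm_triangle_ineq2[of x \<xi>] by (simp add: dist_norm norm_minus_commute)
    then have "cball \<xi> \<rho> \<subseteq> U" using rU by blast
    then show "g holomorphic_on ball \<xi> \<rho>" "continuous_on (cball \<xi> \<rho>) g"
      using gU holomorphic_on_subset holomorphic_on_imp_continuous_on ball_subset_cball by blast+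
    show "cmod (g x) \<le> M" if "cmod (\<xi> - x) = \<rho>" for x
      unfolding g_def using in_r[of x] that by (intro M in_ball) (auto simp: dist_norm)
  qed fact
  have "cmod (L u) \<le> M / r" using est[of 0 r 1] r dg0 by simp
  then show "cmod (L v) \<le> M / r * norm v"
    using mult_right_mono[of "cmod (L u)" "M / r" "norm v"]
    unfolding Lv by (simp add: norm_mult mult.commute[of "norm v"])
  assume v: "norm v \<le> r / 2"
  have r2: "cball 0 (r/2) \<subseteq> U" using rU r by (auto simp: subset_iff)
  have "cmod ((deriv ^^ 0) g (of_real (norm v)) - (\<Sum>i\<le>1. (deriv ^^ i) g 0 * (of_real (norm v) - 0) ^ i / fact i))
      \<le> (8 * M / r\<^sup>2) * cmod (of_real (norm v) - 0) ^ (Suc 1) / fact 1"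
  proof (rule complex_Taylor[where S="cball 0 (r/2)"])
    fix i :: nat and x :: complex assume x: "x \<in> cball 0 (r/2)"
    have "((deriv ^^ i) g) holomorphic_on U" by (rule holomorphic_higher_deriv[OF gU U])
    then have "((deriv ^^ i) g has_field_derivative deriv ((deriv ^^ i) g) x) (at x)"
      using U r2 x by (intro holomorphic_derivI) auto
    then show "((deriv ^^ i) g has_field_derivative (deriv ^^ Suc i) g x) (at x within cball 0 (r/2))"
      by (simp add: has_field_derivative_at_within)
    show "cmod ((deriv ^^ Suc 1) g x) \<le> 8 * M / r\<^sup>2"
      using est[of x "r/2" 2] x r by (simp add: numeral_2_eq_2 power_divide field_simps power2_eq_square)
  qed (use v r in auto)
  moreover have "g (of_real (norm v)) = f (z + v)" using vu by (simp add: g_def)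
  moreover have "g 0 = f z" by (simp add: g_def)
  ultimately show "cmod (f (z + v) - f z - L v) \<le> 8 * M / r\<^sup>2 * (norm v)\<^sup>2"
    by (simp add: dg0 Lv power2_eq_square algebra_simps)
qed

section \<open>Uniform limits, Lipschitz bounds and directional derivatives\<close>

text \<open>
  The first-order Cauchy estimate, applied to differences \<open>f k - f m\<close>, makes the derivatives at
  \<open>z\<close> a Cauchy sequence; the second-order one holds with a constant independent of \<open>k\<close> and therefore
  survives in the limit, where it says that the limit of the derivatives is the derivative of the
  limit.
\<close>

lemma holomorphic_uniform_limit:
  fixes f :: "nat \<Rightarrow> complex ^ 'n \<Rightarrow> complex"
  assumes hol: "\<And>k. holomorphic_fun_on (f k) (ball z0 r)"
    and lim: "uniform_limit (ball z0 r) f g sequentially"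
  shows "holomorphic_fun_on g (ball z0 r)"
  unfolding holomorphic_fun_on_def
proof
  fix z assume z: "z \<in> ball z0 r"
  then obtain \<rho> where \<rho>: "0 < \<rho>" "cball z \<rho> \<subseteq> ball z0 r"
    using open_contains_cball[of "ball z0 r"] by (meson open_ball)
  have "\<forall>k. \<exists>L. (f k has_derivative L) (at z) \<and> (\<forall>c v. L (c *s v) = c * L v)"
    using hol z unfolding holomorphic_fun_on_def by blast
  then obtain L where L: "\<And>k. (f k has_derivative L k) (at z)"
    and lin: "\<And>k c v. L k (c *s v) = c * L k v" by metis
  have ev: "\<forall>\<^sub>F k in sequentially. \<forall>x\<in>ball z0 r. cmod (f k x - g x) < e" if "0 < e" for e
    using lim that unfolding uniform_limit_iff dist_norm by blast
  obtain N0 where N0: "\<And>k x. k \<ge> N0 \<Longrightarrow> x \<in> ball z0 r \<Longrightarrow> cmod (f k x - g x) < 1"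
    using ev[OF zero_less_one] unfolding eventually_sequentially by blast
  have "compact (f N0 ` cball z \<rho>)"
    using holomorphic_fun_on_continuous[OF hol] \<rho>(2)
    by (intro compact_continuous_image) (auto intro: continuous_on_subset)
  then obtain B where B: "\<And>x. x \<in> cball z \<rho> \<Longrightarrow> cmod (f N0 x) \<le> B"
    using compact_imp_bounded bounded_iff by (metis imageI)
  define M where "M = B + 2"
  have M: "cmod (f k x) \<le> M" if "k \<ge> N0" "x \<in> cball z \<rho>" for k x
  proof -
    have x: "x \<in> ball z0 r" using that \<rho> by auto
    have "cmod (f k x) \<le> cmod (f N0 x) + cmod (f k x - g x) + cmod (f N0 x - g x)"
      by norm
    then show ?thesis
      using N0[OF that(1) x] N0[OF order_refl x] B[OF that(2)] unfolding M_def by linarith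
  qed
  have M0: "0 \<le> M" using order_trans[OF norm_ge_zero M[of N0 z]] \<rho> by simp
  have bnd: "cmod (L k v) \<le> M / \<rho> * norm v" if "k \<ge> N0" for k v
    by (rule cauchy_first_order[OF hol open_ball \<rho>(2,1) M[OF that] L lin])
  have diff: "\<forall>\<^sub>F k in sequentially. \<forall>\<^sub>F m in sequentially. cmod (L k v - L m v) \<le> e / \<rho> * norm v"
    if e: "0 < e" for e v
  proof -
    obtain N where N: "\<And>k x. k \<ge> N \<Longrightarrow> x \<in> ball z0 r \<Longrightarrow> cmod (f k x - g x) < e/2"
      using ev[OF half_gt_zero[OF e]] unfolding eventually_sequentially by blast
    have "cmod (L k v - L m v) \<le> e / \<rho> * norm v" if k: "k \<ge> N" and m: "m \<ge> N" for k m
    proof (rule cauchy_first_order[OF _ open_ball \<rho>(2,1),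
          where f="\<lambda>x. f k x - f m x" and L="\<lambda>v. L k v - L m v"])
      show "holomorphic_fun_on (\<lambda>x. f k x - f m x) (ball z0 r)"
        by (intro holomorphic_fun_diff hol)
      fix x assume "x \<in> cball z \<rho>"
      then have "x \<in> ball z0 r" using \<rho> by auto
      then show "cmod (f k x - f m x) \<le> e"
        using N[OF k, of x] N[OF m, of x] norm_triangle_ineq4[of "f k x - g x" "f m x - g x"] by simp
    qed (auto intro: has_derivative_diff L simp: lin algebra_simps)
    then show ?thesis unfolding eventually_sequentially by blast
  qed
  have "convergent (\<lambda>k. L k v)" for v
  proof (rule Cauchy_convergent, rule CauchyI)
    fix e :: real assume e: "0 < e"
    define e' where "e' = e * \<rho> / (2 * (norm v + 1))"
    have e': "0 < e'" using e \<rho> by (simp add: e'_def add_nonneg_pos)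
    have nv: "0 < norm v + 1" by (simp add: add_nonneg_pos)
    have "e' / \<rho> * norm v = e / 2 * (norm v / (norm v + 1))"
      using \<rho> nv by (simp add: e'_def)
    also have "\<dots> < e / 2 * 1"
      using e nv by (intro mult_strict_left_mono) auto
    finally have "e' / \<rho> * norm v < e / 2" by simp
    moreover obtain N where "\<forall>\<^sub>F m in sequentially. cmod (L N v - L m v) \<le> e' / \<rho> * norm v"
      using diff[OF e', of v] unfolding eventually_sequentially by blast
    ultimately obtain N' where N': "\<And>m. m \<ge> N' \<Longrightarrow> cmod (L N v - L m v) < e / 2"
      unfolding eventually_sequentially by (meson le_less_trans)
    show "\<exists>M. \<forall>m\<ge>M. \<forall>n\<ge>M. norm (L m v - L n v) < e"
    proof (intro exI[of _ N'] allI impI)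
      fix m n assume "N' \<le> m" "N' \<le> n"
      then show "norm (L m v - L n v) < e"
        using N'[of m] N'[of n] norm_triangle_ineq4[of "L N v - L n v" "L N v - L m v"] by simp
    qed
  qed
  then obtain D where D: "\<And>v. (\<lambda>k. L k v) \<longlonglongrightarrow> D v"
    unfolding convergent_def by metis
  have glim: "(\<lambda>k. f k x) \<longlonglongrightarrow> g x" if "x \<in> ball z0 r" for x
    by (rule tendsto_uniform_limitI[OF lim that])
  have Dbnd: "cmod (D v) \<le> M / \<rho> * norm v" for v
    by (rule Lim_bounded[OF tendsto_norm[OF D], of N0]) (use bnd in auto)
  have Dadd: "D (v + w) = D v + D w" for v w
  proof (rule LIMSEQ_unique[OF D])
    have "L k (v + w) = L k v + L k w" for k
      using has_derivative_bounded_linear[OF L] by (intro linear_add bounded_linear.linear)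
    then show "(\<lambda>k. L k (v + w)) \<longlonglongrightarrow> D v + D w" by (simp add: tendsto_add D)
  qed
  have Dc: "D (c *s v) = c * D v" for c v
    by (rule LIMSEQ_unique[OF D]) (simp add: lin tendsto_mult D)
  have bl: "bounded_linear D"
  proof (rule bounded_linear_intro[where K="M/\<rho>"])
    show "D (r *\<^sub>R x) = r *\<^sub>R D x" for r x
      by (simp add: scaleR_eq_cscale Dc scaleR_conv_of_real)
  qed (use Dadd Dbnd in \<open>auto simp: mult.commute\<close>)
  have quad: "cmod (g (z + v) - g z - D v) \<le> 8 * M / \<rho>\<^sup>2 * (norm v)\<^sup>2" if v: "norm v \<le> \<rho> / 2" for v
  proof (rule Lim_bounded[where M=N0])
    have "z + v \<in> cball z \<rho>" using v \<rho> by (simp add: dist_norm)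
    then show "(\<lambda>k. cmod (f k (z + v) - f k z - L k v)) \<longlonglongrightarrow> cmod (g (z + v) - g z - D v)"
      using \<rho> z by (intro tendsto_norm tendsto_diff D glim) auto
    show "\<forall>k\<ge>N0. cmod (f k (z + v) - f k z - L k v) \<le> 8 * M / \<rho>\<^sup>2 * (norm v)\<^sup>2"
      using cauchy_second_order[OF hol open_ball \<rho>(2,1) M L lin v] by blast
  qed
  have "(g has_derivative D) (at z)"
    unfolding has_derivative_at
  proof (intro conjI bl)
    show "(\<lambda>h. norm (g (z + h) - g z - D h) / norm h) \<midarrow>0\<rightarrow> 0"
    proof (rule Lim_null_comparison)
      show "\<forall>\<^sub>F h in at 0. norm (norm (g (z + h) - g z - D h) / norm h) \<le> 8 * M / \<rho>\<^sup>2 * norm h"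
        unfolding eventually_at
      proof (intro exI[of _ "\<rho>/2"] conjI ballI impI)
        fix h :: "complex ^ 'n" assume h: "h \<noteq> 0 \<and> dist h 0 < \<rho> / 2"
        then have "cmod (g (z + h) - g z - D h) \<le> (8 * M / \<rho>\<^sup>2 * norm h) * norm h"
          using quad[of h] by (simp add: power2_eq_square mult.assoc)
        then show "norm (norm (g (z + h) - g z - D h) / norm h) \<le> 8 * M / \<rho>\<^sup>2 * norm h"
          using h by (simp add: divide_le_eq)
      qed (use \<rho> in auto)
      show "((\<lambda>h. 8 * M / \<rho>\<^sup>2 * norm h) \<longlongrightarrow> 0) (at 0)"
        by (rule tendsto_eq_intros refl | simp)+
    qed
  qed
  then show "\<exists>L. (g has_derivative L) (at z) \<and> (\<forall>c v. L (c *s v) = c * L v)"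
    using Dc by blast
qed

text \<open>
  The derivative is bounded by \<open>M / \<delta>\<close> on every ball \<open>cball y \<delta>\<close> with \<open>y \<in> L\<close>, by the Cauchy
  estimate on balls of radius \<open>\<delta>\<close>, and these balls are convex.
\<close>

lemma holomorphic_fun_lipschitz_near:
  fixes f :: "complex ^ 'n \<Rightarrow> complex"
  assumes hol: "holomorphic_fun_on f S" and S: "open S" and L: "compact L"
    and \<delta>: "0 < \<delta>" and sub: "{x. \<exists>z\<in>L. norm (x - z) \<le> 2 * \<delta>} \<subseteq> S"
  shows "\<exists>\<Lambda>\<ge>0. \<forall>y\<in>L. \<forall>x. norm (x - y) \<le> \<delta> \<longrightarrow> cmod (f x - f y) \<le> \<Lambda> * norm (x - y)"
proof -
  define N where "N = {x. \<exists>z\<in>L. norm (x - z) \<le> 2 * \<delta>}"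
  have "compact (f ` N)"
    unfolding N_def
    by (rule compact_continuous_image[OF continuous_on_subset[OF holomorphic_fun_on_continuous[OF hol] sub]
          compact_closed_neighbourhood[OF L]])
  then obtain M0 where M0: "\<And>x. x \<in> N \<Longrightarrow> cmod (f x) \<le> M0"
    using compact_imp_bounded bounded_iff by (metis imageI)
  define M where "M = max 0 M0"
  have M: "\<And>x. x \<in> N \<Longrightarrow> cmod (f x) \<le> M" using M0 unfolding M_def by (meson max.coboundedI2)
  show ?thesis
  proof (intro exI[of _ "M/\<delta>"] conjI ballI allI impI)
    fix y x assume y: "y \<in> L" and x: "norm (x - y) \<le> \<delta>"
    have cN: "cball p \<delta> \<subseteq> N" if "p \<in> cball y \<delta>" for p
    proof
      fix q assume "q \<in> cball p \<delta>"
      then have "dist q y \<le> 2 * \<delta>"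
        using that dist_triangle[of q y p] by (simp add: dist_commute)
      then show "q \<in> N" using y unfolding N_def dist_norm by blast
    qed
    have "\<exists>A. (f has_derivative A) (at p) \<and> onorm A \<le> M/\<delta>" if p: "p \<in> cball y \<delta>" for p
    proof -
      have "p \<in> cball p \<delta>" using \<delta> by simp
      then have "p \<in> S" using cN[OF p] sub unfolding N_def by blast
      then obtain A where A: "(f has_derivative A) (at p)" "\<And>c v. A (c *s v) = c * A v"
        using hol unfolding holomorphic_fun_on_def by blast
      have "cmod (A v) \<le> M / \<delta> * norm v" for v
        by (rule cauchy_first_order[OF hol S _ \<delta> _ A])
          (use cN[OF p] sub M in \<open>unfold N_def[symmetric], blast+\<close>)
      then show ?thesis using A by (intro exI[of _ A]) (auto intro: onorm_le)
    qed
    then obtain A where A: "\<And>p. p \<in> cball y \<delta> \<Longrightarrow> (f has_derivative A p) (at p)"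
      "\<And>p. p \<in> cball y \<delta> \<Longrightarrow> onorm (A p) \<le> M/\<delta>" by metis
    show "cmod (f x - f y) \<le> M/\<delta> * norm (x - y)"
    proof (rule differentiable_bound[where S="cball y \<delta>"])
      show "onorm (A p) \<le> M/\<delta>" if "p \<in> cball y \<delta>" for p using A that by auto
      show "(f has_derivative A p) (at p within cball y \<delta>)" if "p \<in> cball y \<delta>" for p
        using A that has_derivative_at_withinI by blast
    qed (use x \<delta> in \<open>auto simp: dist_norm norm_minus_commute\<close>)
  qed (use \<delta> in \<open>auto simp: M_def\<close>)
qed

lemma holomorphic_map_lipschitz_near:
  fixes F :: "complex ^ 'n \<Rightarrow> complex ^ 'n"
  assumes hol: "holomorphic_map_on F S" and S: "open S" and L: "compact L" and sub: "L \<subseteq> S"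
  obtains \<delta> \<Lambda> where "0 < \<delta>" "0 \<le> \<Lambda>" "lipschitz_near \<delta> \<Lambda> F L"
    "{x. \<exists>z\<in>L. norm (x - z) \<le> \<delta>} \<subseteq> S"
proof -
  obtain \<epsilon> where \<epsilon>: "0 < \<epsilon>" "{x. \<exists>z\<in>L. norm (x - z) \<le> \<epsilon>} \<subseteq> S"
    using closed_neighbourhood_in_open[OF L S sub] by blast
  define \<delta> where "\<delta> = \<epsilon> / 2"
  have \<delta>: "0 < \<delta>" "{x. \<exists>z\<in>L. norm (x - z) \<le> 2 * \<delta>} \<subseteq> S" using \<epsilon> by (auto simp: \<delta>_def)
  have "\<forall>i. \<exists>\<Lambda>\<ge>0. \<forall>y\<in>L. \<forall>x. norm (x - y) \<le> \<delta> \<longrightarrow> cmod (F x $ i - F y $ i) \<le> \<Lambda> * norm (x - y)"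
    using holomorphic_fun_lipschitz_near[OF _ S L \<delta>] hol unfolding holomorphic_map_on_def by blast
  then obtain \<Lambda> where \<Lambda>0: "\<And>i. 0 \<le> \<Lambda> i" and
    \<Lambda>: "\<And>i y x. y \<in> L \<Longrightarrow> norm (x - y) \<le> \<delta> \<Longrightarrow> cmod (F x $ i - F y $ i) \<le> \<Lambda> i * norm (x - y)"
    by metis
  show thesis
  proof
    show "0 \<le> (\<Sum>i\<in>UNIV. \<Lambda> i)" by (intro sum_nonneg \<Lambda>0)
    show "lipschitz_near \<delta> (\<Sum>i\<in>UNIV. \<Lambda> i) F L"
      unfolding lipschitz_near_def
    proof (intro ballI allI impI)
      fix y x assume "y \<in> L" "norm (x - y) \<le> \<delta>"
      then have "(\<Sum>i\<in>UNIV. cmod ((F x - F y) $ i)) \<le> (\<Sum>i\<in>UNIV. \<Lambda> i * norm (x - y))"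
        by (intro sum_mono) (simp add: \<Lambda>)
      then show "norm (F x - F y) \<le> (\<Sum>i\<in>UNIV. \<Lambda> i) * norm (x - y)"
        using norm_vec_le_sum[of "F x - F y"] by (simp add: sum_distrib_right)
    qed
    have "norm (x - z) \<le> 2 * \<delta>" if "norm (x - z) \<le> \<delta>" for x z :: "complex ^ 'n" using that \<delta> by simp
    then show "{x. \<exists>z\<in>L. norm (x - z) \<le> \<delta>} \<subseteq> S" using \<delta>(2) by blast
  qed (use \<delta> in auto)
qed

text \<open>
  The difference quotients \<open>(f (z + s Y z) - f z) / s\<close> are holomorphic in \<open>z\<close> by composition, and by
  the second-order Cauchy estimate they converge locally uniformly as \<open>s\<close> tends to \<open>0\<close>. The
  direction \<open>Y z\<close> may vary with \<open>z\<close> because this is the form in which push-forwards of fields occur.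
\<close>

lemma holomorphic_directional_derivative:
  fixes f :: "complex ^ 'n \<Rightarrow> complex"
  assumes hol: "holomorphic_fun_on f S" and S: "open S" and Y: "holomorphic_map_on Y S"
  shows "holomorphic_fun_on (\<lambda>z. frechet_derivative f (at z) (Y z)) S"
proof -
  let ?D = "\<lambda>z. frechet_derivative f (at z) (Y z)"
  have "\<exists>\<rho>>0. holomorphic_fun_on ?D (ball z0 \<rho>)" if z0: "z0 \<in> S" for z0
  proof -
    obtain \<epsilon> where \<epsilon>: "0 < \<epsilon>" "cball z0 \<epsilon> \<subseteq> S" using S z0 open_contains_cball by blast
    define \<rho> where "\<rho> = \<epsilon> / 2"
    have \<rho>: "0 < \<rho>" using \<epsilon> by (simp add: \<rho>_def)
    have sub: "cball z \<rho> \<subseteq> cball z0 \<epsilon>" if "z \<in> cball z0 \<rho>" for z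
    proof
      fix w assume "w \<in> cball z \<rho>"
      then show "w \<in> cball z0 \<epsilon>"
        using that dist_triangle[of z0 w z] by (simp add: \<rho>_def)
    qed
    have ballS: "ball z0 \<rho> \<subseteq> S"
      using sub[of z0] \<rho> \<epsilon> ball_subset_cball centre_in_cball less_imp_le subset_trans by metis
    have "compact (f ` cball z0 \<epsilon>)" "compact (Y ` cball z0 \<rho>)"
      using holomorphic_fun_on_continuous[OF hol] holomorphic_map_on_continuous[OF Y] \<epsilon>
      by (auto intro!: compact_continuous_image elim!: continuous_on_subset simp: \<rho>_def)
    then obtain M B where M: "\<And>x. x \<in> cball z0 \<epsilon> \<Longrightarrow> cmod (f x) \<le> M"
      and B: "\<And>x. x \<in> cball z0 \<rho> \<Longrightarrow> norm (Y x) \<le> B"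
      using compact_imp_bounded bounded_iff by (metis imageI)
    have B0: "0 \<le> B" using order_trans[OF norm_ge_zero B[of z0]] \<rho> by simp
    have M0: "0 \<le> M" using order_trans[OF norm_ge_zero M[of z0]] \<epsilon> by simp
    \<comment> \<open>the shift \<open>k0\<close> makes all displacements \<open>s k * Y z\<close> shorter than \<open>\<rho>/2\<close>, as the Cauchy estimate requires\<close>
    obtain k0 :: nat where k0: "2 * B / \<rho> < real k0" using reals_Archimedean2 by blast
    define s where "s k = 1 / real (k + k0 + 1)" for k
    have s: "0 < s k" for k by (simp add: s_def)
    have sB: "s k * B \<le> \<rho> / 2" for k
    proof -
      have "2 * B \<le> \<rho> * real (k + k0 + 1)"
        using k0 \<rho> by (simp add: field_simps) (smt (verit) mult_nonneg_nonneg of_nat_0_le_iff)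
      then show ?thesis by (simp add: s_def field_simps)
    qed
    have sY: "norm (s k *\<^sub>R Y z) \<le> s k * B" if "z \<in> cball z0 \<rho>" for k z
      using B[OF that] s[of k] by (simp add: mult_left_mono)
    define q where "q k z = of_real (1 / s k) * (f (z + s k *\<^sub>R Y z) - f z)" for k z
    have "holomorphic_fun_on ?D (ball z0 \<rho>)"
    proof (rule holomorphic_uniform_limit[of q])
      fix k
      have "holomorphic_fun_on (\<lambda>z. f (z + s k *\<^sub>R Y z)) (ball z0 \<rho>)"
      proof (rule holomorphic_fun_compose[OF hol])
        show "holomorphic_map_on (\<lambda>z. z + s k *\<^sub>R Y z) (ball z0 \<rho>)"
          by (intro holomorphic_map_add holomorphic_map_id holomorphic_map_scaleR
              holomorphic_map_on_subset[OF Y] ballS)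
        fix z assume "z \<in> ball z0 \<rho>"
        then have z: "z \<in> cball z0 \<rho>" by simp
        have "norm (s k *\<^sub>R Y z) \<le> \<rho>" using sY[OF z, of k] sB[of k] \<rho> by linarith
        then have "z + s k *\<^sub>R Y z \<in> cball z \<rho>" by (simp add: dist_norm)
        then show "z + s k *\<^sub>R Y z \<in> S" using sub[OF z] \<epsilon> by blast
      qed
      then show "holomorphic_fun_on (q k) (ball z0 \<rho>)"
        unfolding q_def
        by (intro holomorphic_fun_mult holomorphic_fun_const holomorphic_fun_diff)
          (auto intro!: holomorphic_fun_on_subset[OF hol ballS])
    next
      show "uniform_limit (ball z0 \<rho>) q ?D sequentially"
      proof (rule uniform_limitI)
        fix e :: real assume e: "0 < e"
        define C where "C = 8 * M / \<rho>\<^sup>2 * B\<^sup>2"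
        have bound: "cmod (q k z - ?D z) \<le> C * s k" if z: "z \<in> ball z0 \<rho>" for k z
        proof -
          have zc: "z \<in> cball z0 \<rho>" using z by simp
          have "z \<in> S" using z ballS by blast
          then obtain A where A: "(f has_derivative A) (at z)" "\<And>c v. A (c *s v) = c * A v"
            using hol unfolding holomorphic_fun_on_def by blast
          have D: "?D z = A (Y z)" using frechet_derivative_at[OF A(1)] by simp
          have "cmod (f (z + s k *\<^sub>R Y z) - f z - A (s k *\<^sub>R Y z)) \<le> 8 * M / \<rho>\<^sup>2 * (norm (s k *\<^sub>R Y z))\<^sup>2"
          proof (rule cauchy_second_order[OF hol S _ \<rho> _ A])
            show "norm (s k *\<^sub>R Y z) \<le> \<rho> / 2" using sY[OF zc, of k] sB[of k] by simp
          qed (use sub[OF zc] \<epsilon> M in auto)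
          also have "\<dots> \<le> 8 * M / \<rho>\<^sup>2 * (s k * B)\<^sup>2"
            using sY[OF zc, of k] M0 by (intro mult_left_mono power_mono) auto
          finally have est: "cmod (f (z + s k *\<^sub>R Y z) - f z - A (s k *\<^sub>R Y z)) \<le> C * s k * s k"
            by (simp add: C_def power2_eq_square mult_ac)
          have "A (s k *\<^sub>R Y z) = of_real (s k) * A (Y z)" by (simp add: scaleR_eq_cscale A(2))
          then have "q k z - ?D z = of_real (1 / s k) * (f (z + s k *\<^sub>R Y z) - f z - A (s k *\<^sub>R Y z))"
            using s[of k] by (simp add: q_def D field_simps)
          then have "cmod (q k z - ?D z) = 1 / s k * cmod (f (z + s k *\<^sub>R Y z) - f z - A (s k *\<^sub>R Y z))"
            using s[of k] by (simp add: norm_mult norm_divide)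
          also have "\<dots> \<le> 1 / s k * (C * s k * s k)"
            using est s[of k] by (intro mult_left_mono) auto
          finally show ?thesis using s[of k] by simp
        qed
        have "(\<lambda>k. C * s k) \<longlonglongrightarrow> C * 0"
          unfolding s_def
          using LIMSEQ_ignore_initial_segment[OF LIMSEQ_inverse_real_of_nat, of k0]
          by (intro tendsto_mult tendsto_const) (simp add: inverse_eq_divide add_ac)
        then have "\<forall>\<^sub>F k in sequentially. C * s k < e"
          using e by (intro order_tendstoD(2)[where y=0]) auto
        then show "\<forall>\<^sub>F k in sequentially. \<forall>z\<in>ball z0 \<rho>. dist (q k z) (?D z) < e"
        proof eventually_elim
          case (elim k)
          show ?case using le_less_trans[OF bound elim] unfolding dist_norm by blast
        qed
      qed
    qed
    then show ?thesis using \<rho> by blast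
  qed
  then show ?thesis unfolding holomorphic_fun_on_def by (meson centre_in_ball)
qed

section \<open>Flows of holomorphic vector fields\<close>

lemma holomorphic_automorphismI:
  assumes "holomorphic_map_on \<Phi> UNIV" "holomorphic_map_on \<Psi> UNIV"
    and "\<And>z. \<Psi> (\<Phi> z) = z" "\<And>z. \<Phi> (\<Psi> z) = z"
  shows "holomorphic_automorphism \<Phi>"
proof -
  have "bij \<Phi>" using assms(3,4) by (metis bijI')
  moreover have "inv_into UNIV \<Phi> = \<Psi>"
    by (rule inv_unique_comp) (use assms(3,4) in \<open>auto simp: fun_eq_iff\<close>)
  ultimately show ?thesis
    using assms(1,2) by (simp add: holomorphic_automorphism_def biholomorphic_onto_def)
qed

lemma holomorphic_automorphism_holomorphic:
  "holomorphic_automorphism \<Phi> \<Longrightarrow> holomorphic_map_on \<Phi> UNIV"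
  by (simp add: holomorphic_automorphism_def biholomorphic_onto_def)

lemma holomorphic_automorphism_compose:
  assumes "holomorphic_automorphism \<Phi>" "holomorphic_automorphism \<Psi>"
  shows "holomorphic_automorphism (\<Phi> \<circ> \<Psi>)"
proof -
  have bij: "bij \<Phi>" "bij \<Psi>" and hol: "holomorphic_map_on \<Phi> UNIV" "holomorphic_map_on \<Psi> UNIV"
    "holomorphic_map_on (inv \<Phi>) UNIV" "holomorphic_map_on (inv \<Psi>) UNIV"
    using assms by (simp_all add: holomorphic_automorphism_def biholomorphic_onto_def)
  show ?thesis
  proof (rule holomorphic_automorphismI[where \<Psi>="\<lambda>z. inv \<Psi> (inv \<Phi> z)"])
    show "holomorphic_map_on (\<Phi> \<circ> \<Psi>) UNIV"
      unfolding o_def by (rule holomorphic_map_compose[OF hol(1,2)]) simp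
    show "holomorphic_map_on (\<lambda>z. inv \<Psi> (inv \<Phi> z)) UNIV"
      by (rule holomorphic_map_compose[OF hol(4,3)]) simp
  qed (use bij in \<open>auto simp: bij_def surj_f_inv_f\<close>)
qed

lemma holomorphic_automorphism_id: "holomorphic_automorphism id"
  by (rule holomorphic_automorphismI[where \<Psi>="\<lambda>z. z"]) (auto simp: id_def holomorphic_map_id)

lemma solution_unique:
  assumes hol: "holomorphic_map_on V UNIV" and T: "0 \<le> T"
    and y': "\<And>t. 0 \<le> t \<Longrightarrow> t \<le> T \<Longrightarrow> (y has_vector_derivative V (y t)) (at t)"
    and z': "\<And>t. 0 \<le> t \<Longrightarrow> t \<le> T \<Longrightarrow> (z has_vector_derivative V (z t)) (at t)"
    and eq: "y 0 = z 0"
  shows "y T = z T"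
proof -
  have cpt: "compact (z ` {0..T})"
    using has_vector_derivative_continuous[OF z']
    by (intro compact_continuous_image continuous_at_imp_continuous_on) auto
  obtain \<delta> \<Lambda> where \<delta>: "0 < \<delta>" "0 \<le> \<Lambda>" "lipschitz_near \<delta> \<Lambda> V (z ` {0..T})"
    by (rule holomorphic_map_lipschitz_near[OF hol open_UNIV cpt subset_UNIV])
  have "norm (y T - z T) \<le> norm (y 0 - z 0) * exp (\<Lambda> * T)"
    by (rule gronwall_nearby_solution[OF y' z' _ \<delta>(3,2)]) (use eq T \<delta> in auto)
  then show ?thesis using eq by simp
qed

lemma has_vector_derivative_shift_time:
  assumes "(f has_vector_derivative d) (at (s + t))"
  shows "((\<lambda>u. f (s + u)) has_vector_derivative d) (at t)"
proof -
  have "((\<lambda>u. s + u) has_vector_derivative 1) (at t)" by (auto intro!: derivative_eq_intros)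
  from vector_diff_chain_at[OF this assms] show ?thesis by (simp add: o_def)
qed

lemma has_vector_derivative_reverse_time:
  assumes "(f has_vector_derivative d) (at (s - t))"
  shows "((\<lambda>u. f (s - u)) has_vector_derivative - d) (at t)"
proof -
  have "((\<lambda>u. s - u) has_vector_derivative - 1) (at t)" by (auto intro!: derivative_eq_intros)
  from vector_diff_chain_at[OF this assms] show ?thesis by (simp add: o_def)
qed

context
  fixes V :: "complex ^ 'n \<Rightarrow> complex ^ 'n" and \<phi>
  assumes hol: "holomorphic_map_on V UNIV" and flow: "is_flow V \<phi>"
begin

lemma flow_zero: "\<phi> 0 z = z"
  using flow by (simp add: is_flow_def)

lemma flow_derivative: "((\<lambda>s. \<phi> s z) has_vector_derivative V (\<phi> t z)) (at t)"
  using flow by (simp add: is_flow_def)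

text \<open>
  Only \<open>t \<ge> 0\<close> is treated, because the Gronwall estimate runs forward in time; applied to the
  reversed flow of \<open>- V\<close> the statement also covers negative times.
\<close>

lemma flow_semigroup:
  assumes "0 \<le> t"
  shows "\<phi> t (\<phi> s z) = \<phi> (s + t) z"
  by (rule solution_unique[OF hol assms, where z="\<lambda>u. \<phi> (s + u) z"])
    (auto intro: flow_derivative has_vector_derivative_shift_time simp: flow_zero)

lemma reverse_flow: "is_flow (\<lambda>z. - V z) (\<lambda>t. \<phi> (- t))"
  unfolding is_flow_def
  using flow_zero has_vector_derivative_reverse_time[OF flow_derivative, of 0] by simp

lemma flow_lipschitz_initial:
  assumes T: "0 \<le> T"
  shows "\<exists>r>0. \<exists>C\<ge>0. \<forall>w. norm (w - z) < r \<longrightarrow> (\<forall>t\<in>{0..T}. norm (\<phi> t w - \<phi> t z) \<le> C * norm (w - z))"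
proof -
  have cpt: "compact ((\<lambda>t. \<phi> t z) ` {0..T})"
    using has_vector_derivative_continuous[OF flow_derivative]
    by (intro compact_continuous_image continuous_at_imp_continuous_on) auto
  obtain \<delta> \<Lambda> where \<delta>: "0 < \<delta>" "0 \<le> \<Lambda>" "lipschitz_near \<delta> \<Lambda> V ((\<lambda>t. \<phi> t z) ` {0..T})"
    by (rule holomorphic_map_lipschitz_near[OF hol open_UNIV cpt subset_UNIV])
  show ?thesis
  proof (rule exI[of _ "\<delta> / exp (\<Lambda> * T)"], rule conjI, use \<delta> in simp,
      rule exI[of _ "exp (\<Lambda> * T)"], intro conjI allI impI ballI)
    fix w t assume w: "norm (w - z) < \<delta> / exp (\<Lambda> * T)" and t: "t \<in> {0..T}"
    have "norm (\<phi> t w - \<phi> t z) \<le> norm (\<phi> 0 w - \<phi> 0 z) * exp (\<Lambda> * t)"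
      by (rule gronwall_nearby_solution[OF flow_derivative flow_derivative _ \<delta>(3,2)])
        (use t w in \<open>auto simp: flow_zero pos_less_divide_eq\<close>)
    also have "\<dots> \<le> norm (\<phi> 0 w - \<phi> 0 z) * exp (\<Lambda> * T)"
      using t \<delta> by (intro mult_left_mono) (auto intro: mult_left_mono)
    finally show "norm (\<phi> t w - \<phi> t z) \<le> exp (\<Lambda> * T) * norm (w - z)"
      by (simp add: flow_zero mult.commute)
  qed (use \<delta> in auto)
qed

lemma flow_continuous:
  assumes T: "0 \<le> T"
  shows "continuous_on (UNIV \<times> {0..T}) (\<lambda>(z, t). \<phi> t z)"
  unfolding continuous_on_iff
proof (intro ballI allI impI)
  fix p :: "(complex ^ 'n) \<times> real" and e
  assume "p \<in> UNIV \<times> {0..T}" and e: "(0::real) < e"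
  then obtain z t where p: "p = (z, t)" "t \<in> {0..T}" by auto
  obtain r C where r: "0 < r" "0 \<le> C"
    and C: "\<And>w t. norm (w - z) < r \<Longrightarrow> t \<in> {0..T} \<Longrightarrow> norm (\<phi> t w - \<phi> t z) \<le> C * norm (w - z)"
    using flow_lipschitz_initial[OF T, of z] by blast
  have "isCont (\<lambda>t. \<phi> t z) t" by (rule has_vector_derivative_continuous[OF flow_derivative])
  then obtain d where d: "0 < d" "\<And>s. dist s t < d \<Longrightarrow> dist (\<phi> s z) (\<phi> t z) < e/2"
    using e unfolding continuous_at_eps_delta by (metis half_gt_zero)
  define \<eta> where "\<eta> = min (min r d) (e / (2 * (C + 1)))"
  have \<eta>: "0 < \<eta>" using r d e by (simp add: \<eta>_def)
  show "\<exists>d>0. \<forall>x'\<in>UNIV \<times> {0..T}. dist x' p < d \<longrightarrow> dist (case x' of (z, t) \<Rightarrow> \<phi> t z) (case p of (z, t) \<Rightarrow> \<phi> t z) < e"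
  proof (intro exI[of _ \<eta>] conjI \<eta> ballI impI)
    fix x' assume "x' \<in> UNIV \<times> {0..T}" and x': "dist x' p < \<eta>"
    then obtain w s where ws: "x' = (w, s)" "s \<in> {0..T}" by auto
    have w: "norm (w - z) < \<eta>" and s: "dist s t < \<eta>"
      using x' dist_fst_le[of x' p] dist_snd_le[of x' p] by (auto simp: ws p dist_norm)
    have "norm (\<phi> s w - \<phi> s z) \<le> C * norm (w - z)" using w ws by (intro C) (auto simp: \<eta>_def)
    also have "\<dots> \<le> (C + 1) * norm (w - z)" by (intro mult_right_mono) auto
    also have "\<dots> < (C + 1) * (e / (2 * (C + 1)))"
      using w r by (intro mult_strict_left_mono) (auto simp: \<eta>_def)
    also have "\<dots> = e / 2" using r by (simp add: field_simps)
    finally have "dist (\<phi> s w) (\<phi> s z) < e / 2" by (simp add: dist_norm)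
    moreover have "dist (\<phi> s z) (\<phi> t z) < e / 2" using s by (intro d) (simp add: \<eta>_def)
    ultimately show "dist (case x' of (z, t) \<Rightarrow> \<phi> t z) (case p of (z, t) \<Rightarrow> \<phi> t z) < e"
      using dist_triangle[of "\<phi> s w" "\<phi> t z" "\<phi> s z"] by (simp add: ws p)
  qed
qed

lemma flow_compact_tube:
  assumes "0 \<le> T" "compact K"
  shows "compact {\<phi> t z |t z. t \<in> {0..T} \<and> z \<in> K}"
proof -
  have "{\<phi> t z |t z. t \<in> {0..T} \<and> z \<in> K} = (\<lambda>(z, t). \<phi> t z) ` (K \<times> {0..T})"
    by force
  then show ?thesis
    using assms by (auto intro!: compact_continuous_image compact_Times
        continuous_on_subset[OF flow_continuous[OF assms(1)]])
qed

lemma flow_continuous_time_map: "0 \<le> t \<Longrightarrow> continuous_on S (\<phi> t)"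
proof -
  assume t: "0 \<le> t"
  have "continuous_on S ((\<lambda>(z, t). \<phi> t z) \<circ> (\<lambda>z. (z, t)))"
    using t by (intro continuous_on_compose continuous_on_subset[OF flow_continuous[OF t]])
      (auto intro!: continuous_intros)
  then show ?thesis by (simp add: o_def)
qed

text \<open>
  The Euler maps \<open>id + h V\<close> and their iterates are entire, and by the convergence of the Euler scheme
  \<open>\<phi> T\<close> is a locally uniform limit of such iterates.
\<close>

lemma flow_holomorphic:
  assumes T: "0 \<le> T"
  shows "holomorphic_map_on (\<phi> T) UNIV"
proof -
  have "holomorphic_fun_on (\<lambda>z. \<phi> T z $ i) (ball z0 1)" for z0 i
  proof -
    define L where "L = {\<phi> t z |t z. t \<in> {0..T} \<and> z \<in> cball z0 1}"
    have L: "compact L" unfolding L_def by (rule flow_compact_tube[OF T]) auto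
    obtain \<delta> \<Lambda> where \<delta>: "0 < \<delta>" "0 \<le> \<Lambda>" "lipschitz_near \<delta> \<Lambda> V L"
      by (rule holomorphic_map_lipschitz_near[OF hol open_UNIV L subset_UNIV])
    have "compact (V ` L)"
      using holomorphic_map_on_continuous[OF hol] L
      by (intro compact_continuous_image) (auto intro: continuous_on_subset)
    then obtain M where M: "\<And>x. x \<in> L \<Longrightarrow> norm (V x) \<le> M"
      using compact_imp_bounded bounded_iff by (metis imageI)
    have "\<exists>\<Phi>\<in>{\<Phi>. holomorphic_map_on \<Phi> UNIV}. \<forall>p\<in>cball z0 1. norm (\<Phi> (\<phi> 0 p) - \<phi> T p) < \<eta>"
      if "0 < \<eta>" for \<eta>
    proof (rule time_map_approximable[where y="\<lambda>p t. \<phi> t p", OF _ _ _ \<delta>(3,1,2) M T flow_derivative _ that])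
      show "id \<in> {\<Phi>. holomorphic_map_on \<Phi> UNIV}" by (simp add: id_def holomorphic_map_id)
      show "f \<circ> g \<in> {\<Phi>. holomorphic_map_on \<Phi> UNIV}"
        if "f \<in> {\<Phi>. holomorphic_map_on \<Phi> UNIV}" "g \<in> {\<Phi>. holomorphic_map_on \<Phi> UNIV}"
        for f g :: "complex ^ 'n \<Rightarrow> complex ^ 'n"
        using that holomorphic_map_compose[of f UNIV g UNIV] by (simp add: o_def)
      show "generated_by {\<Phi>. holomorphic_map_on \<Phi> UNIV} V {x. \<exists>z\<in>L. norm (x - z) \<le> \<delta>}"
        unfolding generated_by_def
      proof (intro allI impI exI[of _ 1] conjI)
        fix \<epsilon> h :: real assume "0 < \<epsilon>" "0 < h \<and> h \<le> 1"
        then show "\<exists>S\<in>{\<Phi>. holomorphic_map_on \<Phi> UNIV}. \<forall>x\<in>{x. \<exists>z\<in>L. norm (x - z) \<le> \<delta>}.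
              norm (S x - (x + h *\<^sub>R V x)) \<le> \<epsilon> * h"
          by (intro bexI[of _ "\<lambda>x. x + h *\<^sub>R V x"])
            (auto intro!: holomorphic_map_add holomorphic_map_id holomorphic_map_scaleR hol)
      qed simp
    qed (auto simp: L_def)
    then have "\<forall>k::nat. \<exists>\<Phi>. holomorphic_map_on \<Phi> UNIV \<and> (\<forall>p\<in>cball z0 1. norm (\<Phi> p - \<phi> T p) < 1 / real (Suc k))"
      by (simp add: flow_zero)
    then obtain \<Phi> where \<Phi>: "\<And>k. holomorphic_map_on (\<Phi> k) UNIV"
      "\<And>k p. p \<in> cball z0 1 \<Longrightarrow> norm (\<Phi> k p - \<phi> T p) < 1 / real (Suc k)" by metis
    show ?thesis
    proof (rule holomorphic_uniform_limit[of "\<lambda>k z. \<Phi> k z $ i"])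
      show "holomorphic_fun_on (\<lambda>z. \<Phi> k z $ i) (ball z0 1)" for k
        using \<Phi>(1) holomorphic_fun_on_subset unfolding holomorphic_map_on_def by blast
      show "uniform_limit (ball z0 1) (\<lambda>k z. \<Phi> k z $ i) (\<lambda>z. \<phi> T z $ i) sequentially"
      proof (rule uniform_limitI)
        fix e :: real assume "0 < e"
        then have "\<forall>\<^sub>F k in sequentially. 1 / real (Suc k) < e"
          using order_tendstoD(2)[OF LIMSEQ_inverse_real_of_nat] by (simp add: inverse_eq_divide)
        then show "\<forall>\<^sub>F k in sequentially. \<forall>x\<in>ball z0 1. dist (\<Phi> k x $ i) (\<phi> T x $ i) < e"
        proof eventually_elim
          case (elim k)
          have "dist (\<Phi> k x $ i) (\<phi> T x $ i) < e" if "x \<in> ball z0 1" for x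
          proof -
            have "dist (\<Phi> k x $ i) (\<phi> T x $ i) \<le> dist (\<Phi> k x) (\<phi> T x)" by (rule dist_vec_nth_le)
            then show ?thesis using \<Phi>(2)[of x k] that elim by (simp add: dist_norm)
          qed
          then show ?case by blast
        qed
      qed
    qed
  qed
  then show ?thesis
    unfolding holomorphic_map_on_def holomorphic_fun_on_def by (meson UNIV_I centre_in_ball zero_less_one)
qed

end

text \<open>
  The inverse of \<open>\<phi> T\<close> is the time-\<open>T\<close> map of the flow of \<open>- V\<close>.
\<close>

lemma flow_automorphism:
  assumes hol: "holomorphic_map_on V UNIV" and flow: "is_flow V \<phi>" and T: "0 \<le> T"
  shows "holomorphic_automorphism (\<phi> T)"
proof -
  have holm: "holomorphic_map_on (\<lambda>z. - V z) UNIV"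
    using holomorphic_map_scaleR[OF hol, of "-1"] by simp
  note rev = reverse_flow[OF hol flow]
  show ?thesis
  proof (rule holomorphic_automorphismI)
    show "holomorphic_map_on (\<phi> T) UNIV" by (rule flow_holomorphic[OF hol flow T])
    show "holomorphic_map_on (\<phi> (- T)) UNIV" by (rule flow_holomorphic[OF holm rev T])
    show "\<phi> (- T) (\<phi> T z) = z" for z
      using flow_semigroup[OF holm rev T, of "- T" z] flow_zero[OF hol flow] by simp
    show "\<phi> T (\<phi> (- T) z) = z" for z
      using flow_semigroup[OF hol flow T, of "- T" z] flow_zero[OF hol flow] by simp
  qed
qed

section \<open>Polynomial vector fields are generated by automorphisms\<close>

abbreviation Aut :: "(complex ^ 'n \<Rightarrow> complex ^ 'n) set" where
  "Aut \<equiv> {\<Phi>. holomorphic_automorphism \<Phi>}"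

text \<open>
  Continuity is part of the notion because it is what makes the class closed under addition:
  there \<open>W\<close> is evaluated at slightly displaced points.
\<close>

definition automorphism_generated :: "(complex ^ 'n \<Rightarrow> complex ^ 'n) \<Rightarrow> bool" where
  "automorphism_generated W \<longleftrightarrow>
     continuous_on UNIV W \<and> (\<forall>C. compact C \<longrightarrow> generated_by Aut W C)"

lemma generated_byE:
  assumes "generated_by \<A> W C" "0 < \<epsilon>"
  obtains h0 where "0 < h0"
    "\<forall>h. 0 < h \<and> h \<le> h0 \<longrightarrow> (\<exists>S\<in>\<A>. \<forall>x\<in>C. norm (S x - (x + h *\<^sub>R W x)) \<le> \<epsilon> * h)"
proof -
  have "\<exists>h0>0. \<forall>h. 0 < h \<and> h \<le> h0 \<longrightarrow> (\<exists>S\<in>\<A>. \<forall>x\<in>C. norm (S x - (x + h *\<^sub>R W x)) \<le> \<epsilon> * h)"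
    using assms unfolding generated_by_def by (elim allE[of _ \<epsilon>]) simp
  then show thesis using that by (elim exE conjE) simp
qed

lemma generated_by_approximation:
  assumes "\<And>\<epsilon>. 0 < \<epsilon> \<Longrightarrow> \<exists>W'. generated_by \<A> W' C \<and> (\<forall>x\<in>C. norm (W' x - W x) \<le> \<epsilon>)"
  shows "generated_by \<A> W C"
  unfolding generated_by_def
proof (intro allI impI)
  fix \<epsilon> :: real assume e: "0 < \<epsilon>"
  then obtain W' where W': "generated_by \<A> W' C" and close: "\<And>x. x \<in> C \<Longrightarrow> norm (W' x - W x) \<le> \<epsilon>/2"
    using assms[of "\<epsilon>/2"] by auto
  obtain h0 where h0: "0 < h0" and
    S: "\<forall>h. 0 < h \<and> h \<le> h0 \<longrightarrow> (\<exists>S\<in>\<A>. \<forall>x\<in>C. norm (S x - (x + h *\<^sub>R W' x)) \<le> \<epsilon>/2 * h)"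
    by (rule generated_byE[OF W' half_gt_zero[OF e]])
  show "\<exists>h0>0. \<forall>h. 0 < h \<and> h \<le> h0 \<longrightarrow> (\<exists>S\<in>\<A>. \<forall>x\<in>C. norm (S x - (x + h *\<^sub>R W x)) \<le> \<epsilon> * h)"
  proof (intro exI[of _ h0] conjI h0 allI impI)
    fix h assume h: "0 < h \<and> h \<le> h0"
    then obtain S where SA: "S \<in> \<A>" and S: "\<And>x. x \<in> C \<Longrightarrow> norm (S x - (x + h *\<^sub>R W' x)) \<le> \<epsilon>/2 * h"
      using S by blast
    have "norm (S x - (x + h *\<^sub>R W x)) \<le> \<epsilon> * h" if "x \<in> C" for x
    proof -
      have "S x - (x + h *\<^sub>R W x) = (S x - (x + h *\<^sub>R W' x)) + h *\<^sub>R (W' x - W x)"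
        by (simp add: algebra_simps)
      also have "norm \<dots> \<le> \<epsilon>/2 * h + h * (\<epsilon>/2)"
        using S[OF that] close[OF that] h by (intro norm_triangle_mono) (auto intro: mult_left_mono)
      finally show ?thesis by (simp add: algebra_simps)
    qed
    then show "\<exists>S\<in>\<A>. \<forall>x\<in>C. norm (S x - (x + h *\<^sub>R W x)) \<le> \<epsilon> * h" using SA by blast
  qed
qed

lemma automorphism_generated_limit:
  fixes W :: "complex ^ 'n \<Rightarrow> complex ^ 'n"
  assumes "continuous_on UNIV W"
    and "\<And>C \<epsilon>. compact C \<Longrightarrow> 0 < \<epsilon> \<Longrightarrow>
        \<exists>W'. automorphism_generated W' \<and> (\<forall>x\<in>C. norm (W' x - W x) \<le> \<epsilon>)"
  shows "automorphism_generated W"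
  unfolding automorphism_generated_def
proof (intro conjI allI impI generated_by_approximation assms(1))
  fix C :: "(complex ^ 'n) set" and \<epsilon> :: real
  assume C: "compact C" and e: "0 < \<epsilon>"
  show "\<exists>W'. generated_by Aut W' C \<and> (\<forall>x\<in>C. norm (W' x - W x) \<le> \<epsilon>)"
    using assms(2)[OF C e] C unfolding automorphism_generated_def by blast
qed

text \<open>
  If \<open>T1\<close> and \<open>T2\<close> are steps for the two fields, then \<open>T2 \<circ> T1\<close> is a step for the sum: \<open>T1\<close> moves
  the points of \<open>C\<close> by \<open>O(h)\<close> only, and \<open>W2\<close> is uniformly continuous on the closed
  \<open>1\<close>-neighbourhood of \<open>C\<close>.
\<close>

lemma automorphism_generated_add:
  fixes W1 W2 :: "complex ^ 'n \<Rightarrow> complex ^ 'n"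
  assumes W1: "automorphism_generated W1" and W2: "automorphism_generated W2"
  shows "automorphism_generated (\<lambda>z. W1 z + W2 z)"
  unfolding automorphism_generated_def
proof (intro conjI allI impI)
  show "continuous_on UNIV (\<lambda>z. W1 z + W2 z)"
    using W1 W2 by (auto simp: automorphism_generated_def intro: continuous_on_add)
  fix C :: "(complex ^ 'n) set" assume C: "compact C"
  define C' where "C' = {x. \<exists>z\<in>C. norm (x - z) \<le> 1}"
  have C': "compact C'" unfolding C'_def by (rule compact_closed_neighbourhood[OF C])
  show "generated_by Aut (\<lambda>z. W1 z + W2 z) C"
    unfolding generated_by_def
  proof (intro allI impI)
    fix \<epsilon> :: real assume e: "0 < \<epsilon>"
    then have e3: "0 < \<epsilon>/3" by simp
    have "uniformly_continuous_on C' W2"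
      using W2 by (intro compact_uniformly_continuous C')
        (auto simp: automorphism_generated_def intro: continuous_on_subset)
    then obtain d where d: "0 < d" and W2c: "\<And>x x'. x \<in> C' \<Longrightarrow> x' \<in> C' \<Longrightarrow> dist x' x < d \<Longrightarrow> dist (W2 x') (W2 x) < \<epsilon>/3"
      using e3 unfolding uniformly_continuous_on_def by meson
    have "compact (W1 ` C)"
      using W1 by (intro compact_continuous_image C)
        (auto simp: automorphism_generated_def intro: continuous_on_subset)
    then obtain M0 where M0: "\<And>x. x \<in> C \<Longrightarrow> norm (W1 x) \<le> M0"
      using compact_imp_bounded bounded_iff by (metis imageI)
    define M where "M = \<bar>M0\<bar> + 1"
    have M: "0 < M" "\<And>x. x \<in> C \<Longrightarrow> norm (W1 x) \<le> M" using M0 by (force simp: M_def)+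
    obtain h1 where h1: "0 < h1" and
      S1: "\<forall>h. 0 < h \<and> h \<le> h1 \<longrightarrow> (\<exists>S\<in>Aut. \<forall>x\<in>C. norm (S x - (x + h *\<^sub>R W1 x)) \<le> \<epsilon>/3 * h)"
      by (rule generated_byE[OF _ e3]) (use W1 C in \<open>auto simp: automorphism_generated_def\<close>)
    obtain h2 where h2: "0 < h2" and
      S2: "\<forall>h. 0 < h \<and> h \<le> h2 \<longrightarrow> (\<exists>S\<in>Aut. \<forall>x\<in>C'. norm (S x - (x + h *\<^sub>R W2 x)) \<le> \<epsilon>/3 * h)"
      by (rule generated_byE[OF _ e3]) (use W2 C' in \<open>auto simp: automorphism_generated_def\<close>)
    define h0 where "h0 = min (min h1 h2) (min (1 / (M + \<epsilon>)) (d / (M + \<epsilon>)))"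
    have h0: "0 < h0" using h1 h2 M e d by (simp add: h0_def)
    show "\<exists>h0>0. \<forall>h. 0 < h \<and> h \<le> h0 \<longrightarrow>
        (\<exists>S\<in>Aut. \<forall>x\<in>C. norm (S x - (x + h *\<^sub>R (W1 x + W2 x))) \<le> \<epsilon> * h)"
    proof (intro exI[of _ h0] conjI h0 allI impI)
      fix h assume h: "0 < h \<and> h \<le> h0"
      then have hh: "0 < h \<and> h \<le> h1" "0 < h \<and> h \<le> h2" by (auto simp: h0_def)
      obtain T1 where T1: "T1 \<in> Aut" "\<And>x. x \<in> C \<Longrightarrow> norm (T1 x - (x + h *\<^sub>R W1 x)) \<le> \<epsilon>/3 * h"
        using S1 hh(1) by blast
      obtain T2 where T2: "T2 \<in> Aut" "\<And>x. x \<in> C' \<Longrightarrow> norm (T2 x - (x + h *\<^sub>R W2 x)) \<le> \<epsilon>/3 * h"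
        using S2 hh(2) by blast
      have hM: "h * (M + \<epsilon>) \<le> 1" "h * (M + \<epsilon>) \<le> d"
        using h M e by (auto simp: h0_def pos_le_divide_eq)
      have "norm ((T2 \<circ> T1) x - (x + h *\<^sub>R (W1 x + W2 x))) \<le> \<epsilon> * h" if x: "x \<in> C" for x
      proof -
        have "T1 x - x = (T1 x - (x + h *\<^sub>R W1 x)) + h *\<^sub>R W1 x" by simp
        also have "norm \<dots> \<le> \<epsilon>/3 * h + h * M"
          using T1(2)[OF x] M(2)[OF x] h by (intro norm_triangle_mono) (auto intro: mult_left_mono)
        also have "\<dots> < h * (M + \<epsilon>)" using e h by (simp add: algebra_simps)
        finally have near: "norm (T1 x - x) < h * (M + \<epsilon>)" .
        have x': "T1 x \<in> C'" using near hM x by (force simp: C'_def)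
        have xC: "x \<in> C'" using x by (force simp: C'_def)
        have "norm (W2 (T1 x) - W2 x) \<le> \<epsilon>/3"
          using W2c[OF xC x'] near hM by (simp add: dist_norm)
        then have n2: "norm (h *\<^sub>R (W2 (T1 x) - W2 x)) \<le> h * (\<epsilon>/3)"
          using h by (auto intro: mult_left_mono)
        have "(T2 \<circ> T1) x - (x + h *\<^sub>R (W1 x + W2 x)) =
            (T2 (T1 x) - (T1 x + h *\<^sub>R W2 (T1 x))) + h *\<^sub>R (W2 (T1 x) - W2 x) + (T1 x - (x + h *\<^sub>R W1 x))"
          by (simp add: algebra_simps)
        also have "norm \<dots> \<le> \<epsilon>/3 * h + h * (\<epsilon>/3) + \<epsilon>/3 * h"
          by (intro norm_triangle_mono T2(2) x' n2 T1(2) x)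
        finally show ?thesis by (simp add: algebra_simps)
      qed
      moreover have "T2 \<circ> T1 \<in> Aut" using T1 T2 by (auto intro: holomorphic_automorphism_compose)
      ultimately show "\<exists>S\<in>Aut. \<forall>x\<in>C. norm (S x - (x + h *\<^sub>R (W1 x + W2 x))) \<le> \<epsilon> * h" by blast
    qed
  qed
qed

lemma automorphism_generated_zero: "automorphism_generated (\<lambda>z. 0)"
  unfolding automorphism_generated_def generated_by_def
  by (auto intro!: exI[of _ 1] bexI[of _ id] holomorphic_automorphism_id)

lemma automorphism_generated_sum:
  assumes "finite I" "\<And>i. i \<in> I \<Longrightarrow> automorphism_generated (W i)"
  shows "automorphism_generated (\<lambda>z. \<Sum>i\<in>I. W i z)"
  using assms by (induction I rule: finite_induct)
    (auto simp: automorphism_generated_zero intro: automorphism_generated_add)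

text \<open>
  The step \<open>z + h g(z) v\<close> is exactly invertible, because \<open>g\<close> is constant in the direction \<open>v\<close>.
\<close>

lemma automorphism_generated_shear:
  fixes g :: "complex ^ 'n \<Rightarrow> complex"
  assumes hol: "holomorphic_fun_on g UNIV" and inv: "\<And>z c. g (z + c *s v) = g z"
  shows "automorphism_generated (\<lambda>z. g z *s v)"
  unfolding automorphism_generated_def generated_by_def
proof (intro conjI allI impI exI[of _ 1])
  have W: "holomorphic_map_on (\<lambda>z. g z *s v) UNIV"
    by (intro holomorphic_map_cscale hol holomorphic_map_const)
  then show "continuous_on UNIV (\<lambda>z. g z *s v)" by (rule holomorphic_map_on_continuous)
  fix C :: "(complex ^ 'n) set" and \<epsilon> h :: real
  assume "0 < \<epsilon>" "0 < h \<and> h \<le> 1"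
  have inv': "g (z + r *\<^sub>R (c *s v)) = g z" for z r c
    by (simp add: scaleR_eq_cscale vector_smult_assoc inv)
  have "holomorphic_automorphism (\<lambda>z. z + h *\<^sub>R (g z *s v))"
  proof (rule holomorphic_automorphismI[where \<Psi>="\<lambda>z. z + (- h) *\<^sub>R (g z *s v)"])
    show "holomorphic_map_on (\<lambda>z. z + (- h) *\<^sub>R (g z *s v)) UNIV"
      "holomorphic_map_on (\<lambda>z. z + h *\<^sub>R (g z *s v)) UNIV"
      by (intro holomorphic_map_add holomorphic_map_id holomorphic_map_scaleR W)+
  qed (simp_all only: inv' add.assoc scaleR_left_distrib[symmetric], simp_all)
  then show "\<exists>S\<in>Aut. \<forall>x\<in>C. norm (S x - (x + h *\<^sub>R (g x *s v))) \<le> \<epsilon> * h"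
    using \<open>0 < \<epsilon>\<close> \<open>0 < h \<and> h \<le> 1\<close> by (intro bexI[of _ "\<lambda>z. z + h *\<^sub>R (g z *s v)"]) auto
qed simp

lemma exp_second_order: "cmod (exp w - 1 - w) \<le> (cmod w)\<^sup>2 * exp (cmod w)"
proof -
  have "cmod (exp w - 1 - w) \<le> exp \<bar>Re w\<bar> * (cmod w)\<^sup>2"
    using Taylor_exp[of w 1] by (simp add: diff_diff_eq power2_eq_square)
  also have "\<dots> \<le> exp (cmod w) * (cmod w)\<^sup>2"
    using abs_Re_le_cmod[of w] by (intro mult_right_mono) auto
  finally show ?thesis by (simp add: mult.commute)
qed

text \<open>
  The flow of this field is explicit: \<open>g\<close> is constant along it and \<open>\<nu>\<close> is multiplied by
  \<open>exp (h g)\<close>, which leads to \<open>z + (exp (h g(z)) - 1) \<nu>(z) v\<close>.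
\<close>

lemma automorphism_generated_overshear:
  fixes g \<nu> :: "complex ^ 'n \<Rightarrow> complex"
  assumes g: "holomorphic_fun_on g UNIV" and \<nu>: "holomorphic_fun_on \<nu> UNIV"
    and g_inv: "\<And>z c. g (z + c *s v) = g z" and \<nu>_v: "\<And>z c. \<nu> (z + c *s v) = \<nu> z + c"
  shows "automorphism_generated (\<lambda>z. (g z * \<nu> z) *s v)"
  unfolding automorphism_generated_def
proof (intro conjI allI impI)
  have "holomorphic_map_on (\<lambda>z. (g z * \<nu> z) *s v) UNIV"
    by (intro holomorphic_map_cscale holomorphic_fun_mult g \<nu> holomorphic_map_const)
  then show "continuous_on UNIV (\<lambda>z. (g z * \<nu> z) *s v)" by (rule holomorphic_map_on_continuous)
  define E where "E h z = z + ((exp (of_real h * g z) - 1) * \<nu> z) *s v" for h z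
  have E_hol: "holomorphic_map_on (E h) UNIV" for h
    unfolding E_def
    by (intro holomorphic_map_add holomorphic_map_id holomorphic_map_cscale holomorphic_fun_mult
        holomorphic_fun_diff holomorphic_fun_exp holomorphic_fun_const g \<nu> holomorphic_map_const)
  have E_inv: "E (- h) (E h z) = z" for h z
  proof -
    define k where "k = (exp (of_real h * g z) - 1) * \<nu> z"
    have "E (- h) (E h z) = z + (k + (exp (- (of_real h * g z)) - 1) * (\<nu> z + k)) *s v"
      unfolding E_def k_def[symmetric] g_inv \<nu>_v by (simp add: vec_eq_iff algebra_simps)
    also have "k + (exp (- (of_real h * g z)) - 1) * (\<nu> z + k) = 0"
      by (simp add: k_def exp_minus field_simps)
    finally show ?thesis by simp
  qed
  have E_aut: "holomorphic_automorphism (E h)" for h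
    by (rule holomorphic_automorphismI[OF E_hol E_hol E_inv]) (use E_inv[of "- h"] in simp)
  fix C :: "(complex ^ 'n) set" assume C: "compact C"
  have "compact (g ` C)" "compact (\<nu> ` C)"
    using holomorphic_fun_on_continuous[OF g] holomorphic_fun_on_continuous[OF \<nu>] C
    by (auto intro!: compact_continuous_image intro: continuous_on_subset)
  then obtain G N where G: "\<And>x. x \<in> C \<Longrightarrow> cmod (g x) \<le> G" and N: "\<And>x. x \<in> C \<Longrightarrow> cmod (\<nu> x) \<le> N"
    using compact_imp_bounded bounded_iff by (metis imageI)
  define D where "D = G\<^sup>2 * exp G * N * norm v"
  show "generated_by Aut (\<lambda>z. (g z * \<nu> z) *s v) C"
    unfolding generated_by_def
  proof (intro allI impI)
    fix \<epsilon> :: real assume e: "0 < \<epsilon>"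
    show "\<exists>h0>0. \<forall>h. 0 < h \<and> h \<le> h0 \<longrightarrow>
        (\<exists>S\<in>Aut. \<forall>x\<in>C. norm (S x - (x + h *\<^sub>R ((g x * \<nu> x) *s v))) \<le> \<epsilon> * h)"
    proof (intro exI[of _ "min 1 (\<epsilon> / (\<bar>D\<bar> + 1))"] conjI allI impI)
      fix h assume h: "0 < h \<and> h \<le> min 1 (\<epsilon> / (\<bar>D\<bar> + 1))"
      have "norm (E h x - (x + h *\<^sub>R ((g x * \<nu> x) *s v))) \<le> \<epsilon> * h" if x: "x \<in> C" for x
      proof -
        have G0: "0 \<le> G" and N0: "0 \<le> N"
          using order_trans[OF norm_ge_zero G[OF x]] order_trans[OF norm_ge_zero N[OF x]] by auto
        define w where "w = of_real h * g x"
        have w: "cmod w \<le> h * G" "cmod w \<le> G"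
        proof -
          show "cmod w \<le> h * G" using G[OF x] h by (simp add: w_def norm_mult mult_left_mono)
          also have "\<dots> \<le> 1 * G" using h G0 by (intro mult_right_mono) auto
          finally show "cmod w \<le> G" by simp
        qed
        have "E h x - (x + h *\<^sub>R ((g x * \<nu> x) *s v)) = ((exp w - 1 - w) * \<nu> x) *s v"
          unfolding scaleR_eq_cscale by (simp add: E_def w_def vec_eq_iff algebra_simps)
        then have "norm (E h x - (x + h *\<^sub>R ((g x * \<nu> x) *s v))) = cmod (exp w - 1 - w) * cmod (\<nu> x) * norm v"
          by (simp add: norm_cscale norm_mult)
        also have "\<dots> \<le> ((h * G)\<^sup>2 * exp G) * N * norm v"
        proof (intro mult_right_mono mult_mono)
          have "cmod (exp w - 1 - w) \<le> (cmod w)\<^sup>2 * exp (cmod w)" by (rule exp_second_order)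
          also have "\<dots> \<le> (h * G)\<^sup>2 * exp G" using w by (intro mult_mono power_mono) auto
          finally show "cmod (exp w - 1 - w) \<le> (h * G)\<^sup>2 * exp G" .
        qed (use N[OF x] in auto)
        also have "\<dots> = D * h * h" by (simp add: D_def power2_eq_square mult_ac)
        also have "\<dots> \<le> \<epsilon> * h"
        proof (intro mult_right_mono)
          have "D * h \<le> (\<bar>D\<bar> + 1) * h" using h by (intro mult_right_mono) auto
          also have "\<dots> \<le> \<epsilon>" using h by (simp add: pos_le_divide_eq mult.commute)
          finally show "D * h \<le> \<epsilon>" .
        qed (use h in auto)
        finally show ?thesis .
      qed
      then show "\<exists>S\<in>Aut. \<forall>x\<in>C. norm (S x - (x + h *\<^sub>R ((g x * \<nu> x) *s v))) \<le> \<epsilon> * h"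
        using E_aut[of h] by blast
    qed (use e in auto)
  qed
qed

text \<open>
  Both bounds say that \<open>exp (c x)\<close> is close to its expansion at \<open>c = 0\<close>, uniformly for \<open>x\<close> in a
  disc; they are used to differentiate families of exponentials with respect to a parameter.
\<close>

lemma exp_difference_quotient_uniform:
  assumes "0 < \<epsilon>"
  obtains c :: real where "0 < c"
    "\<And>x. cmod x \<le> R \<Longrightarrow> cmod ((exp (of_real c * x) - 1) / of_real c - x) \<le> \<epsilon>"
    "\<And>x. cmod x \<le> R \<Longrightarrow> cmod (exp (of_real c * x) - 1) \<le> \<epsilon>"
proof -
  define r where "r = \<bar>R\<bar> + 1"
  define B where "B = r\<^sup>2 * exp r + r"
  have r: "0 < r" "R \<le> r" by (auto simp: r_def)
  have B: "0 < B" using r by (simp add: B_def add_pos_pos)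
  define c where "c = min 1 (\<epsilon> / B)"
  have c: "0 < c" "c \<le> 1" "c * B \<le> \<epsilon>" using assms B by (auto simp: c_def min_def pos_le_divide_eq)
  have q: "cmod (exp (of_real c * x) - 1 - of_real c * x) \<le> c * (c * (r\<^sup>2 * exp r))" if "cmod x \<le> R" for x
  proof -
    have x: "cmod (of_real c * x) \<le> c * r" using that r c by (simp add: norm_mult mult_left_mono)
    have "c * r \<le> 1 * r" using c r by (intro mult_right_mono) auto
    with x have "cmod (of_real c * x) \<le> r" by linarith
    with x have "(cmod (of_real c * x))\<^sup>2 * exp (cmod (of_real c * x)) \<le> (c * r)\<^sup>2 * exp r"
      by (intro mult_mono power_mono) auto
    then show ?thesis
      using exp_second_order[of "of_real c * x"] by (simp add: power2_eq_square mult_ac)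
  qed
  show thesis
  proof
    fix x assume x: "cmod x \<le> R"
    have "c * (r\<^sup>2 * exp r) \<le> c * B" using c r by (intro mult_left_mono) (auto simp: B_def)
    then have cb: "c * (r\<^sup>2 * exp r) \<le> \<epsilon>" using c by linarith
    have "(exp (of_real c * x) - 1) / of_real c - x = (exp (of_real c * x) - 1 - of_real c * x) / of_real c"
      using c by (simp add: diff_divide_distrib)
    also have "cmod \<dots> \<le> c * (r\<^sup>2 * exp r)"
      using q[OF x] c by (simp add: norm_divide divide_le_eq mult.commute)
    also note cb
    finally show "cmod ((exp (of_real c * x) - 1) / of_real c - x) \<le> \<epsilon>" .
    have "cmod (exp (of_real c * x) - 1) \<le> cmod (exp (of_real c * x) - 1 - of_real c * x) + cmod (of_real c * x)"
      using norm_triangle_ineq[of "exp (of_real c * x) - 1 - of_real c * x" "of_real c * x"] by simp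
    also have "\<dots> \<le> c * (c * (r\<^sup>2 * exp r)) + c * r"
      using q[OF x] x r c by (intro add_mono) (auto simp: norm_mult mult_left_mono)
    also have "c * (c * (r\<^sup>2 * exp r)) \<le> 1 * (c * (r\<^sup>2 * exp r))"
      using c r by (intro mult_right_mono) auto
    then have "c * (c * (r\<^sup>2 * exp r)) + c * r \<le> c * B" by (simp add: B_def algebra_simps)
    also note c(3)
    finally show "cmod (exp (of_real c * x) - 1) \<le> \<epsilon>" by simp
  qed (rule c)
qed

definition linear_form :: "complex ^ 'n \<Rightarrow> complex ^ 'n \<Rightarrow> complex" where
  "linear_form a z = (\<Sum>i\<in>UNIV. a $ i * z $ i)"

lemma linear_form_add_right: "linear_form a (z + w) = linear_form a z + linear_form a w"
  by (simp add: linear_form_def sum.distrib algebra_simps)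

lemma linear_form_cscale_right: "linear_form a (c *s z) = c * linear_form a z"
  by (simp add: linear_form_def sum_distrib_left algebra_simps)

lemma linear_form_axis: "linear_form a (axis i c) = a $ i * c"
  by (simp add: linear_form_def axis_def if_distrib[of "(*) _"] cong: if_cong)

lemma linear_form_add_left: "linear_form (a + b) z = linear_form a z + linear_form b z"
  by (simp add: linear_form_def sum.distrib algebra_simps)

lemma linear_form_axis_left: "linear_form (axis i c) z = c * z $ i"
  by (simp add: linear_form_def axis_def if_distrib[of "\<lambda>x. x * _"] cong: if_cong)

lemma linear_form_zero: "linear_form 0 z = 0"
  by (simp add: linear_form_def)

lemma holomorphic_fun_sum:
  "finite I \<Longrightarrow> (\<And>i. i \<in> I \<Longrightarrow> holomorphic_fun_on (f i) S) \<Longrightarrow> holomorphic_fun_on (\<lambda>z. \<Sum>i\<in>I. f i z) S"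
  by (induction I rule: finite_induct) (auto intro: holomorphic_fun_const holomorphic_fun_add)

lemma holomorphic_linear_form: "holomorphic_fun_on (linear_form a) S"
  unfolding linear_form_def
  by (intro holomorphic_fun_sum holomorphic_fun_mult holomorphic_fun_const holomorphic_fun_component) simp

lemma bounded_on_compact:
  assumes "compact C" "continuous_on C f"
  obtains B where "0 \<le> B" "\<And>x. x \<in> C \<Longrightarrow> norm (f x) \<le> B"
proof -
  have "bounded (f ` C)" using assms by (intro compact_imp_bounded compact_continuous_image)
  then obtain B where "\<And>x. x \<in> C \<Longrightarrow> norm (f x) \<le> B"
    unfolding bounded_iff by blast
  then show thesis by (intro that[of "\<bar>B\<bar>"]) force+
qed

text \<open>
  Let \<open>\<lambda>\<close> be the linear form with coefficients \<open>a\<close> and \<open>w\<close> the \<open>j\<close>-th basis vector. If \<open>\<lambda>(w) = 0\<close>, the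
  field is a shear. Otherwise \<open>n > 1\<close> provides another coordinate \<open>\<nu>(z) = z $ i\<close> and a vector \<open>u\<close> with
  \<open>\<lambda>(u) = 0\<close>, \<open>\<nu>(u) = 1\<close>, while \<open>\<nu>(w) = 0\<close>. For \<open>c > 0\<close> the form \<open>\<lambda> + c \<nu>\<close> vanishes on
  \<open>w - (a $ j / c) u\<close>, so that
  \<open>exp (\<lambda> + c \<nu>) (w - (a $ j / c) u) + (a $ j / c) exp (\<lambda>) u + a $ j \<nu> exp (\<lambda>) u\<close>
  is a sum of two shears and an overshear. As \<open>c\<close> tends to \<open>0\<close> the coefficient of \<open>u\<close> tends
  to \<open>- a $ j \<nu> exp (\<lambda>) + a $ j \<nu> exp (\<lambda>) = 0\<close>, and the whole field tends to \<open>exp (\<lambda>) w\<close>.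
  The constant factor \<open>b\<close> can be put into each of the three terms.
\<close>

lemma automorphism_generated_exponential:
  fixes a :: "complex ^ 'n"
  assumes card: "CARD('n) > 1"
  shows "automorphism_generated (\<lambda>z. (b * exp (linear_form a z)) *s axis j 1)"
proof (cases "a $ j = 0")
  case True
  show ?thesis
  proof (rule automorphism_generated_shear)
    show "holomorphic_fun_on (\<lambda>z. b * exp (linear_form a z)) UNIV"
      by (intro holomorphic_fun_mult holomorphic_fun_const holomorphic_fun_exp holomorphic_linear_form)
  qed (simp add: linear_form_add_right linear_form_cscale_right linear_form_axis True)
next
  case False
  obtain i where ij: "i \<noteq> j"
    using card by (metis (full_types) UNIV_I card_1_singleton_iff is_singletonI' is_singleton_altdef
        less_irrefl One_nat_def UNIV_not_empty)
  define w :: "complex ^ 'n" where "w = axis j 1"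
  define u :: "complex ^ 'n" where "u = axis i 1 + axis j (- (a $ i / a $ j))"
  have a_u: "linear_form a u = 0" using False by (simp add: u_def linear_form_add_right linear_form_axis)
  have a_w: "linear_form a w = a $ j" by (simp add: w_def linear_form_axis)
  have ui: "u $ i = 1" using ij by (simp add: u_def axis_def)
  have a_inv: "linear_form a (z + c *s u) = linear_form a z" for z c
    by (simp add: linear_form_add_right linear_form_cscale_right a_u)
  have shear_u: "automorphism_generated (\<lambda>z. (d * exp (linear_form a z)) *s u)" for d
    by (rule automorphism_generated_shear)
      (auto intro!: holomorphic_fun_mult holomorphic_fun_const holomorphic_fun_exp holomorphic_linear_form
        simp: a_inv)
  have over_u: "automorphism_generated (\<lambda>z. (d * exp (linear_form a z) * z $ i) *s u)" for d
    by (rule automorphism_generated_overshear)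
      (auto intro!: holomorphic_fun_mult holomorphic_fun_const holomorphic_fun_exp holomorphic_linear_form
        holomorphic_fun_component simp: a_inv ui)
  have shear_c: "automorphism_generated (\<lambda>z. (b * exp (linear_form a z + of_real c * z $ i)) *s (w + (- (a $ j / of_real c)) *s u))"
    if c: "0 < c" for c :: real
  proof (rule automorphism_generated_shear)
    have "holomorphic_fun_on (\<lambda>z. exp (linear_form a z + of_real c * z $ i)) UNIV"
      by (intro holomorphic_fun_exp holomorphic_fun_add holomorphic_fun_mult holomorphic_fun_const
          holomorphic_linear_form holomorphic_fun_component)
    then show "holomorphic_fun_on (\<lambda>z. b * exp (linear_form a z + of_real c * z $ i)) UNIV"
      by (intro holomorphic_fun_mult holomorphic_fun_const)
    define q where "q = w + (- (a $ j / of_real c)) *s u"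
    have q: "linear_form a q = a $ j" "q $ i = - (a $ j / of_real c)"
    proof -
      show "linear_form a q = a $ j"
        unfolding q_def linear_form_add_right linear_form_cscale_right a_u a_w by simp
      show "q $ i = - (a $ j / of_real c)"
        using ij by (simp add: q_def u_def w_def axis_def)
    qed
    have "linear_form a (z + d *s q) + of_real c * (z + d *s q) $ i = linear_form a z + of_real c * z $ i" for z d
      using c by (simp add: linear_form_add_right linear_form_cscale_right q algebra_simps)
    then show "b * exp (linear_form a (z + d *s (w + (- (a $ j / of_real c)) *s u))
        + of_real c * (z + d *s (w + (- (a $ j / of_real c)) *s u)) $ i)
        = b * exp (linear_form a z + of_real c * z $ i)" for z d by (simp only: q_def)
  qed
  define W where "W z = (b * exp (linear_form a z)) *s w" for z
  have W_hol: "holomorphic_map_on W UNIV"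
    unfolding W_def
    by (intro holomorphic_map_cscale holomorphic_fun_mult holomorphic_fun_const holomorphic_fun_exp
        holomorphic_linear_form holomorphic_map_const)
  have "automorphism_generated W"
  proof (rule automorphism_generated_limit)
    show "continuous_on UNIV W" using W_hol by (rule holomorphic_map_on_continuous)
    fix C :: "(complex ^ 'n) set" and \<epsilon> :: real
    assume C: "compact C" and e: "0 < \<epsilon>"
    obtain R where R: "0 \<le> R" "\<And>z. z \<in> C \<Longrightarrow> norm z \<le> R"
      by (rule bounded_on_compact[OF C continuous_on_id]) auto
    obtain E where E: "0 \<le> E" "\<And>z. z \<in> C \<Longrightarrow> cmod (b * exp (linear_form a z)) \<le> E"
      by (rule bounded_on_compact[OF C, where f="\<lambda>z. b * exp (linear_form a z)"])
        (auto intro!: holomorphic_fun_on_continuous holomorphic_fun_mult holomorphic_fun_const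
          holomorphic_fun_exp holomorphic_linear_form)
    define B where "B = E * (norm w + cmod (a $ j) * norm u) + 1"
    have B: "0 < B" using E by (simp add: B_def add_nonneg_pos)
    then have eB: "0 < \<epsilon> / B" using e by simp
    obtain c :: real where c: "0 < c"
      and c1: "\<And>x. cmod x \<le> R \<Longrightarrow> cmod ((exp (of_real c * x) - 1) / of_real c - x) \<le> \<epsilon> / B"
      and c2: "\<And>x. cmod x \<le> R \<Longrightarrow> cmod (exp (of_real c * x) - 1) \<le> \<epsilon> / B"
      using exp_difference_quotient_uniform[OF eB] by metis
    define W' where "W' z = (b * exp (linear_form a z + of_real c * z $ i)) *s (w + (- (a $ j / of_real c)) *s u)
        + ((b * a $ j / of_real c) * exp (linear_form a z)) *s u
        + (b * a $ j * exp (linear_form a z) * z $ i) *s u" for z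
    have "automorphism_generated W'"
      unfolding W'_def by (intro automorphism_generated_add shear_c c shear_u over_u)
    moreover have "norm (W' z - W z) \<le> \<epsilon>" if z: "z \<in> C" for z
    proof -
      define x where "x = z $ i"
      define f where "f = b * exp (linear_form a z)"
      have x: "cmod x \<le> R" using R(2)[OF z] Finite_Cartesian_Product.norm_nth_le[of z i] by (simp add: x_def)
      have "W' z - W z = f *s ((exp (of_real c * x) - 1) *s w
            + (- (a $ j) * ((exp (of_real c * x) - 1) / of_real c - x)) *s u)"
        using c by (simp add: W'_def W_def f_def x_def vec_eq_iff exp_add field_simps)
      also have "norm \<dots> \<le> E * (\<epsilon> / B * norm w + cmod (a $ j) * (\<epsilon> / B) * norm u)"
      proof -
        have "norm ((exp (of_real c * x) - 1) *s w) \<le> \<epsilon> / B * norm w"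
          unfolding norm_cscale by (intro mult_right_mono c2 x) simp
        moreover have "norm ((- (a $ j) * ((exp (of_real c * x) - 1) / of_real c - x)) *s u) \<le> cmod (a $ j) * (\<epsilon> / B) * norm u"
          unfolding norm_cscale norm_mult norm_minus_cancel by (intro mult_right_mono mult_left_mono c1 x) simp_all
        ultimately show ?thesis
          unfolding norm_cscale[of f] using E(2)[OF z] E(1)
          by (intro mult_mono norm_triangle_mono) (auto simp: f_def)
      qed
      also have "\<dots> = (B - 1) * (\<epsilon> / B)"
      proof -
        have "E * (q * norm w + cmod (a $ j) * q * norm u) = (B - 1) * q" for q
          by (simp add: B_def algebra_simps)
        then show ?thesis .
      qed
      also have "\<dots> \<le> B * (\<epsilon> / B)" using eB by (intro mult_right_mono) auto
      also have "\<dots> = \<epsilon>" using B by simp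
      finally show ?thesis .
    qed
    ultimately show "\<exists>W'. automorphism_generated W' \<and> (\<forall>x\<in>C. norm (W' x - W x) \<le> \<epsilon>)" by blast
  qed
  then show ?thesis unfolding W_def[abs_def] w_def .
qed

text \<open>
  Differentiating \<open>m(z) exp (\<lambda>(z) + c z $ i)\<close> with respect to \<open>c\<close> at \<open>0\<close> produces the factor \<open>z $ i\<close>.
  The exponential factor is carried along so that the step can be repeated.
\<close>

lemma automorphism_generated_monomial_step:
  fixes m :: "complex ^ 'n \<Rightarrow> complex"
  assumes m: "continuous_on UNIV m"
    and gen: "\<And>a b. automorphism_generated (\<lambda>z. (b * m z * exp (linear_form a z)) *s axis j 1)"
  shows "automorphism_generated (\<lambda>z. (b * (z $ i * m z) * exp (linear_form a z)) *s axis j 1)"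
proof (rule automorphism_generated_limit)
  have cont: "continuous_on UNIV (\<lambda>z. b * m z * exp (linear_form a z))"
    by (intro continuous_intros m holomorphic_fun_on_continuous holomorphic_linear_form)
  have "(b * (z $ i * m z) * exp (linear_form a z)) *s axis j 1 =
      axis j (z $ i * (b * m z * exp (linear_form a z)))" for z :: "complex ^ 'n"
    by (simp add: vec_eq_iff axis_def)
  then show "continuous_on UNIV (\<lambda>z. (b * (z $ i * m z) * exp (linear_form a z)) *s (axis j 1 :: complex ^ 'n))"
    using bounded_linear.continuous_on[OF bounded_linear_axis continuous_on_mult[OF continuous_on_component[OF continuous_on_id, of UNIV i] cont]]
    by simp
  fix C :: "(complex ^ 'n) set" and \<epsilon> :: real
  assume C: "compact C" and e: "0 < \<epsilon>"
  obtain R where R: "0 \<le> R" "\<And>z. z \<in> C \<Longrightarrow> norm z \<le> R"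
    by (rule bounded_on_compact[OF C continuous_on_id]) auto
  obtain E where E: "0 \<le> E" "\<And>z. z \<in> C \<Longrightarrow> cmod (b * m z * exp (linear_form a z)) \<le> E"
    by (rule bounded_on_compact[OF C continuous_on_subset[OF cont subset_UNIV]]) auto
  have eE: "0 < \<epsilon> / (E + 1)" using e E by simp
  obtain c :: real where c: "0 < c"
    and c1: "\<And>x. cmod x \<le> R \<Longrightarrow> cmod ((exp (of_real c * x) - 1) / of_real c - x) \<le> \<epsilon> / (E + 1)"
    using exp_difference_quotient_uniform[OF eE] by metis
  \<comment> \<open>the difference quotient with step \<open>c\<close>\<close>
  define W' where "W' z = ((b / of_real c) * m z * exp (linear_form (a + axis i (of_real c)) z)) *s axis j 1
      + ((- (b / of_real c)) * m z * exp (linear_form a z)) *s (axis j 1 :: complex ^ 'n)" for z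
  have "automorphism_generated W'"
    unfolding W'_def by (intro automorphism_generated_add gen)
  moreover have "norm (W' z - (b * (z $ i * m z) * exp (linear_form a z)) *s axis j 1) \<le> \<epsilon>" if z: "z \<in> C" for z
  proof -
    define x where "x = z $ i"
    define f where "f = b * m z * exp (linear_form a z)"
    have x: "cmod x \<le> R" using R(2)[OF z] Finite_Cartesian_Product.norm_nth_le[of z i] by (simp add: x_def)
    have "W' z - (b * (z $ i * m z) * exp (linear_form a z)) *s axis j 1 =
        (f * ((exp (of_real c * x) - 1) / of_real c - x)) *s axis j 1"
      using c by (simp add: W'_def f_def x_def vec_eq_iff exp_add linear_form_add_left linear_form_axis_left field_simps)
    then have "norm (W' z - (b * (z $ i * m z) * exp (linear_form a z)) *s axis j 1) =
        cmod f * cmod ((exp (of_real c * x) - 1) / of_real c - x)"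
      by (simp add: norm_cscale norm_mult)
    also have "\<dots> \<le> (E + 1) * (\<epsilon> / (E + 1))"
      using E(2)[OF z] E(1) by (intro mult_mono c1 x) (auto simp: f_def)
    also have "\<dots> = \<epsilon>" using E by simp
    finally show ?thesis .
  qed
  ultimately show "\<exists>W'. automorphism_generated W' \<and>
      (\<forall>z\<in>C. norm (W' z - (b * (z $ i * m z) * exp (linear_form a z)) *s axis j 1) \<le> \<epsilon>)" by blast
qed

lemma automorphism_generated_monomial:
  fixes \<alpha> :: "'n::finite \<Rightarrow> nat"
  assumes card: "CARD('n) > 1"
  shows "automorphism_generated
    (\<lambda>z. (b * (\<Prod>i\<in>UNIV. (z $ i) ^ \<alpha> i) * exp (linear_form a z)) *s (axis j 1 :: complex ^ 'n))"
proof -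
  have "automorphism_generated
      (\<lambda>z. (b * (\<Prod>i\<in>I. (z $ i) ^ \<alpha> i) * exp (linear_form a z)) *s (axis j 1 :: complex ^ 'n))"
    if "finite I" for I a b
    using that
  proof (induction I arbitrary: a b rule: finite_induct)
    case empty
    then show ?case using automorphism_generated_exponential[OF card] by simp
  next
    case (insert k I)
    have "automorphism_generated
        (\<lambda>z. (b * ((z $ k) ^ p * (\<Prod>i\<in>I. (z $ i) ^ \<alpha> i)) * exp (linear_form a z)) *s (axis j 1 :: complex ^ 'n))"
      for p a b
    proof (induction p arbitrary: a b)
      case 0
      then show ?case using insert.IH by simp
    next
      case (Suc p)
      have "continuous_on UNIV (\<lambda>z :: complex ^ 'n. (z $ k) ^ p * (\<Prod>i\<in>I. (z $ i) ^ \<alpha> i))"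
        by (intro continuous_intros)
      from automorphism_generated_monomial_step[OF this Suc.IH] show ?case
        by (simp add: mult.assoc)
    qed
    then show ?case using insert.hyps by simp
  qed
  from this[of UNIV] show ?thesis by simp
qed

lemma automorphism_generated_polynomial:
  fixes P :: "complex ^ 'n \<Rightarrow> complex ^ 'n"
  assumes card: "CARD('n) > 1" and P: "\<And>i. polynomial_fun (\<lambda>z. P z $ i)"
  shows "automorphism_generated P"
proof -
  have "automorphism_generated (\<lambda>z. axis j (P z $ j) :: complex ^ 'n)" for j
  proof -
    obtain A :: "('n \<Rightarrow> nat) set" and c where A: "finite A"
      and Pj: "\<And>z. P z $ j = (\<Sum>\<alpha>\<in>A. c \<alpha> * (\<Prod>i\<in>UNIV. (z $ i) ^ \<alpha> i))"
      using P[of j] unfolding polynomial_fun_def by blast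
    have "automorphism_generated (\<lambda>z. \<Sum>\<alpha>\<in>A. (c \<alpha> * (\<Prod>i\<in>UNIV. (z $ i) ^ \<alpha> i)
        * exp (linear_form 0 z)) *s (axis j 1 :: complex ^ 'n))"
      by (intro automorphism_generated_sum A automorphism_generated_monomial card)
    moreover have "(\<Sum>\<alpha>\<in>A. (c \<alpha> * (\<Prod>i\<in>UNIV. (z $ i) ^ \<alpha> i) * exp (linear_form 0 z)) *s axis j 1)
        = (axis j (P z $ j) :: complex ^ 'n)" for z
      by (auto simp: Pj linear_form_zero vec_eq_iff axis_def)
    ultimately show ?thesis by simp
  qed
  then have "automorphism_generated (\<lambda>z. \<Sum>j\<in>UNIV. axis j (P z $ j))"
    by (intro automorphism_generated_sum) auto
  then show ?thesis by (simp add: sum_axis_components)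
qed

section \<open>Approximation of biholomorphic maps onto Runge domains\<close>

text \<open>
  On the compact set \<open>C\<close> the Runge property approximates each component of \<open>W\<close> by a polynomial, and
  polynomial fields are generated by automorphisms on every compact set.
\<close>

lemma generated_on_runge_domain:
  fixes W :: "complex ^ 'n \<Rightarrow> complex ^ 'n"
  assumes card: "CARD('n) > 1" and runge: "runge_domain D"
    and W: "holomorphic_map_on W D" and C: "compact C" "C \<subseteq> D"
  shows "generated_by Aut W C"
proof (rule generated_by_approximation)
  fix \<epsilon> :: real assume e: "0 < \<epsilon>"
  have "\<forall>i. \<exists>p. polynomial_fun p \<and> (\<forall>z\<in>C. cmod (p z - W z $ i) < \<epsilon> / CARD('n))"
    using runge W C e unfolding runge_domain_def holomorphic_map_on_def by simp
  then obtain p where p: "\<And>i. polynomial_fun (p i)"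
    and close: "\<And>i z. z \<in> C \<Longrightarrow> cmod (p i z - W z $ i) < \<epsilon> / CARD('n)" by metis
  define P where "P z = (\<chi> i. p i z)" for z
  have "automorphism_generated P"
    by (rule automorphism_generated_polynomial[OF card]) (simp add: P_def p)
  moreover have "norm (P z - W z) \<le> \<epsilon>" if z: "z \<in> C" for z
  proof -
    have "norm (P z - W z) \<le> (\<Sum>i\<in>UNIV. cmod ((P z - W z) $ i))" by (rule norm_vec_le_sum)
    also have "\<dots> \<le> (\<Sum>i\<in>(UNIV :: 'n set). \<epsilon> / CARD('n))"
      using close[OF z] by (intro sum_mono) (simp add: P_def less_imp_le)
    finally show ?thesis by simp
  qed
  ultimately show "\<exists>W'. generated_by Aut W' C \<and> (\<forall>x\<in>C. norm (W' x - W x) \<le> \<epsilon>)"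
    using C unfolding automorphism_generated_def by blast
qed

text \<open>
  The push-forward is \<open>DF (F\<^sup>-\<^sup>1 w) (Y (F\<^sup>-\<^sup>1 w))\<close>. It is written in components because the
  derivatives of component functions are the ones known to be holomorphic.
\<close>

definition pushforward_field ::
    "(complex ^ 'n \<Rightarrow> complex ^ 'n) \<Rightarrow> (complex ^ 'n) set \<Rightarrow> (complex ^ 'n \<Rightarrow> complex ^ 'n) \<Rightarrow>
      complex ^ 'n \<Rightarrow> complex ^ 'n" where
  "pushforward_field F S Y w =
     (\<chi> i. frechet_derivative (\<lambda>z. F z $ i) (at (inv_into S F w)) (Y (inv_into S F w)))"

lemma biholomorphic_inverse:
  assumes "biholomorphic_onto F S T"
  shows "z \<in> S \<Longrightarrow> F z \<in> T" "z \<in> S \<Longrightarrow> inv_into S F (F z) = z"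
    "w \<in> T \<Longrightarrow> inv_into S F w \<in> S" "w \<in> T \<Longrightarrow> F (inv_into S F w) = w"
proof -
  have "bij_betw F S T" using assms by (simp add: biholomorphic_onto_def)
  then show "z \<in> S \<Longrightarrow> F z \<in> T" "z \<in> S \<Longrightarrow> inv_into S F (F z) = z"
    "w \<in> T \<Longrightarrow> inv_into S F w \<in> S" "w \<in> T \<Longrightarrow> F (inv_into S F w) = w"
    by (auto simp: bij_betw_def inv_into_into f_inv_into_f)
qed

lemma pushforward_field_holomorphic:
  assumes F: "biholomorphic_onto F S T" and S: "open S" and Y: "holomorphic_map_on Y S"
  shows "holomorphic_map_on (pushforward_field F S Y) T"
  unfolding holomorphic_map_on_def
proof
  fix i
  have hol: "holomorphic_fun_on (\<lambda>z. F z $ i) S" "holomorphic_map_on (inv_into S F) T"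
    using F by (auto simp: biholomorphic_onto_def holomorphic_map_on_def)
  show "holomorphic_fun_on (\<lambda>w. pushforward_field F S Y w $ i) T"
    unfolding pushforward_field_def vec_lambda_beta
    by (rule holomorphic_fun_compose[OF holomorphic_directional_derivative[OF hol(1) S Y] hol(2)])
      (rule biholomorphic_inverse[OF F])
qed

lemma pushforward_trajectory:
  assumes F: "biholomorphic_onto F S T" and x: "x t \<in> S"
    and x': "(x has_vector_derivative Y (x t)) (at t)"
  shows "((\<lambda>t. F (x t)) has_vector_derivative pushforward_field F S Y (F (x t))) (at t)"
proof -
  obtain A where A: "(F has_derivative A) (at (x t))"
    using F x unfolding biholomorphic_onto_def holomorphic_map_on_iff by blast
  have "frechet_derivative (\<lambda>z. F z $ i) (at (x t)) = (\<lambda>v. A v $ i)" for i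
    using frechet_derivative_at[OF bounded_linear.has_derivative[OF bounded_linear_vec_nth A]] by metis
  then have "pushforward_field F S Y (F (x t)) = A (Y (x t))"
    by (simp add: pushforward_field_def biholomorphic_inverse[OF F] x vec_eq_iff)
  moreover have "((\<lambda>t. F (x t)) has_derivative (\<lambda>h. A (h *\<^sub>R Y (x t)))) (at t)"
    using has_derivative_compose[OF x'[unfolded has_vector_derivative_def] A] .
  moreover have "A (h *\<^sub>R v) = h *\<^sub>R A v" for h v
    by (rule linear_scale[OF bounded_linear.linear[OF has_derivative_bounded_linear[OF A]]])
  ultimately show ?thesis by (simp add: has_vector_derivative_def)
qed

text \<open>
  The curves \<open>F (x p t)\<close> are trajectories, in the compact set \<open>F ` Q\<close>, of the push-forward of \<open>Y\<close>.
  This field is holomorphic on the whole Runge domain \<open>D\<close>, hence generated by automorphisms near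
  \<open>F ` Q\<close>, and the Euler scheme applies.
\<close>

lemma transported_time_map_approximable:
  fixes F :: "complex ^ 'n \<Rightarrow> complex ^ 'n"
  assumes card: "CARD('n) > 1" and runge: "runge_domain D" and F: "biholomorphic_onto F S D"
    and S: "open S" and Y: "holomorphic_map_on Y S" and Q: "compact Q" "Q \<subseteq> S" and T: "0 \<le> T"
    and x': "\<And>p t. p \<in> P \<Longrightarrow> 0 \<le> t \<Longrightarrow> t \<le> T \<Longrightarrow> (x p has_vector_derivative Y (x p t)) (at t)"
    and xQ: "\<And>p t. p \<in> P \<Longrightarrow> 0 \<le> t \<Longrightarrow> t \<le> T \<Longrightarrow> x p t \<in> Q"
    and \<eta>: "0 < \<eta>"
  shows "\<exists>\<Phi>\<in>Aut. \<forall>p\<in>P. norm (\<Phi> (F (x p 0)) - F (x p T)) < \<eta>"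
proof -
  define W where "W = pushforward_field F S Y"
  have W: "holomorphic_map_on W D"
    unfolding W_def by (rule pushforward_field_holomorphic[OF F S Y])
  have D: "open D" using runge by (simp add: runge_domain_def is_domain_def)
  have "holomorphic_map_on F S" using F by (simp add: biholomorphic_onto_def)
  then have L: "compact (F ` Q)"
    using Q by (intro compact_continuous_image)
      (auto intro: holomorphic_map_on_continuous holomorphic_map_on_subset)
  have LD: "F ` Q \<subseteq> D" using Q biholomorphic_inverse(1)[OF F] by blast
  obtain \<delta> \<Lambda> where \<delta>: "0 < \<delta>" "0 \<le> \<Lambda>" "lipschitz_near \<delta> \<Lambda> W (F ` Q)"
    "{x. \<exists>z\<in>F ` Q. norm (x - z) \<le> \<delta>} \<subseteq> D"
    by (rule holomorphic_map_lipschitz_near[OF W D L LD])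
  obtain M where M: "\<And>x. x \<in> F ` Q \<Longrightarrow> norm (W x) \<le> M"
    by (rule bounded_on_compact[OF L continuous_on_subset[OF holomorphic_map_on_continuous[OF W] LD]]) blast
  have gen: "generated_by Aut W {x. \<exists>z\<in>F ` Q. norm (x - z) \<le> \<delta>}"
    by (rule generated_on_runge_domain[OF card runge W compact_closed_neighbourhood[OF L] \<delta>(4)])
  show ?thesis
  proof (rule time_map_approximable[where y="\<lambda>p t. F (x p t)", OF _ _ gen \<delta>(3,1,2) M T _ _ \<eta>])
    show "((\<lambda>t. F (x p t)) has_vector_derivative W (F (x p t))) (at t)"
      if "p \<in> P" "0 \<le> t" "t \<le> T" for p t
      unfolding W_def using that xQ[OF that] Q by (intro pushforward_trajectory[OF F] x') auto
  qed (use xQ in \<open>auto intro: holomorphic_automorphism_id holomorphic_automorphism_compose\<close>)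
qed

lemma biholomorphic_derivative_inverse:
  assumes F: "biholomorphic_onto F S T" and S: "open S" and T: "open T" and z: "z \<in> S"
  obtains A B where "(F has_derivative A) (at z)" "(inv_into S F has_derivative B) (at (F z))"
    "\<And>c v. A (c *s v) = c *s A v" "\<And>c v. B (c *s v) = c *s B v"
    "\<And>v. B (A v) = v" "\<And>v. A (B v) = v"
proof -
  let ?G = "inv_into S F"
  note inv = biholomorphic_inverse[OF F]
  have "holomorphic_map_on F S" "holomorphic_map_on ?G T"
    using F by (auto simp: biholomorphic_onto_def)
  then obtain A B where A: "(F has_derivative A) (at z)" "\<And>c v. A (c *s v) = c *s A v"
    and B: "(?G has_derivative B) (at (F z))" "\<And>c v. B (c *s v) = c *s B v"
    using z inv(1)[OF z] unfolding holomorphic_map_on_iff by metis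
  have "((\<lambda>x. ?G (F x)) has_derivative (\<lambda>v. B (A v))) (at z)"
    by (rule has_derivative_compose[OF A(1) B(1)])
  then have "((\<lambda>x. x) has_derivative (\<lambda>v. B (A v))) (at z)"
    by (rule has_derivative_transform_within_open[OF _ S z]) (rule inv(2))
  then have BA: "(\<lambda>v. B (A v)) = (\<lambda>v. v)" by (rule has_derivative_unique) (rule has_derivative_ident)
  have A': "(F has_derivative A) (at (?G (F z)))" using A(1) inv(2)[OF z] by simp
  have "((\<lambda>x. F (?G x)) has_derivative (\<lambda>v. A (B v))) (at (F z))"
    by (rule has_derivative_compose[OF B(1) A'])
  then have "((\<lambda>x. x) has_derivative (\<lambda>v. A (B v))) (at (F z))"
    by (rule has_derivative_transform_within_open[OF _ T inv(1)[OF z]]) (rule inv(4))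
  then have AB: "(\<lambda>v. A (B v)) = (\<lambda>v. v)" by (rule has_derivative_unique) (rule has_derivative_ident)
  show thesis
    by (rule that[OF A(1) B(1) A(2) B(2)]) (use fun_cong[OF BA] fun_cong[OF AB] in auto)
qed

lemma affine_automorphism:
  assumes A: "bounded_linear A" "\<And>c v. A (c *s v) = c *s A v"
    and B: "bounded_linear B" "\<And>c v. B (c *s v) = c *s B v"
    and inv: "\<And>v. B (A v) = v" "\<And>v. A (B v) = v" and s: "s \<noteq> 0"
  shows "holomorphic_automorphism (\<lambda>z. w0 + s *\<^sub>R A z)"
proof (rule holomorphic_automorphismI)
  show "holomorphic_map_on (\<lambda>z. w0 + s *\<^sub>R A z) UNIV"
    by (intro holomorphic_map_add holomorphic_map_const holomorphic_map_scaleR holomorphic_map_linear A)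
  have "holomorphic_map_on (\<lambda>w. B (- w0 + w)) UNIV"
    by (rule holomorphic_map_compose[OF holomorphic_map_linear[OF B, of UNIV]])
      (rule holomorphic_map_add holomorphic_map_const holomorphic_map_id UNIV_I)+
  then show "holomorphic_map_on (\<lambda>w. (1 / s) *\<^sub>R B (- w0 + w)) UNIV" by (rule holomorphic_map_scaleR)
  show "(1 / s) *\<^sub>R B (- w0 + (w0 + s *\<^sub>R A z)) = z" for z
    using s by (simp add: linear_scale[OF bounded_linear.linear[OF B(1)]] inv)
  show "w0 + s *\<^sub>R A ((1 / s) *\<^sub>R B (- w0 + z)) = z" for z
    using s by (simp add: linear_scale[OF bounded_linear.linear[OF A(1)]] inv)
qed

text \<open>
  Let \<open>G\<close> be the inverse of \<open>F\<close>, \<open>w0 = F 0\<close> and \<open>A = DF(0)\<close>. The push-forward of the Euler field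
  \<open>z \<mapsto> z\<close> moves \<open>F x\<close> to \<open>F (exp T x)\<close> in time \<open>T\<close>. Started at \<open>a(z) = w0 + s A z\<close> with
  \<open>s = exp (- T)\<close>, it arrives at \<open>F ((1 / s) G (w0 + s A z))\<close>, and \<open>(1 / s) G (w0 + s A z)\<close> tends to
  \<open>DG(w0) (A z) = z\<close> uniformly on the ball as \<open>s\<close> tends to \<open>0\<close>. So \<open>F\<close> is close to the composition of
  an affine automorphism with a time map that is a limit of automorphisms.
\<close>

lemma approximable_near_origin:
  fixes F :: "complex ^ 'n \<Rightarrow> complex ^ 'n"
  assumes card: "CARD('n) > 1" and runge: "runge_domain D" and F: "biholomorphic_onto F S D"
    and S: "open S" and r: "0 < r" "cball 0 (2 * r) \<subseteq> S" and \<eta>: "0 < \<eta>"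
  shows "\<exists>\<Phi>\<in>Aut. \<forall>z\<in>cball 0 r. norm (\<Phi> z - F z) < \<eta>"
proof -
  let ?G = "inv_into S F"
  define w0 where "w0 = F 0"
  note inv = biholomorphic_inverse[OF F]
  have D: "open D" using runge by (simp add: runge_domain_def is_domain_def)
  have S0: "0 \<in> S" using r by auto
  obtain A B where A: "(F has_derivative A) (at 0)" "\<And>c v. A (c *s v) = c *s A v"
    and B: "(?G has_derivative B) (at w0)" "\<And>c v. B (c *s v) = c *s B v"
    and AB: "\<And>v. B (A v) = v" "\<And>v. A (B v) = v"
    unfolding w0_def by (rule biholomorphic_derivative_inverse[OF F S D S0]) blast
  have bl: "bounded_linear A" "bounded_linear B"
    using A B by (auto intro: has_derivative_bounded_linear)
  obtain k where k: "0 < k" "\<And>v. norm (A v) \<le> norm v * k"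
    using bounded_linear.pos_bounded[OF bl(1)] by blast
  have "continuous_on (cball 0 (2 * r)) F"
    using F r by (auto simp: biholomorphic_onto_def intro: holomorphic_map_on_continuous holomorphic_map_on_subset)
  then have "uniformly_continuous_on (cball 0 (2 * r)) F" by (intro compact_uniformly_continuous) auto
  then obtain d0 where d0: "0 < d0" "\<And>x x'. x \<in> cball 0 (2 * r) \<Longrightarrow> x' \<in> cball 0 (2 * r) \<Longrightarrow>
      dist x' x < d0 \<Longrightarrow> dist (F x') (F x) < \<eta>/2"
    using half_gt_zero[OF \<eta>] unfolding uniformly_continuous_on_def by meson
  define d where "d = min d0 r / 2"
  have d: "0 < d" "d < d0" "d \<le> r" using d0 r by (auto simp: d_def)
  \<comment> \<open>the relative precision that makes the end points \<open>d\<close>-close, as \<open>norm (A z) \<le> k * r\<close> on the ball\<close>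
  define \<kappa> where "\<kappa> = d / (k * r)"
  have \<kappa>: "0 < \<kappa>" using d k r by (simp add: \<kappa>_def)
  then obtain \<sigma> where \<sigma>: "0 < \<sigma>"
    "\<And>w. norm (w - w0) < \<sigma> \<Longrightarrow> norm (?G w - ?G w0 - B (w - w0)) \<le> \<kappa> * norm (w - w0)"
    using B(1) unfolding has_derivative_at_alt by blast
  have "w0 \<in> D" using inv(1)[OF S0] by (simp add: w0_def)
  then obtain \<tau> where \<tau>: "0 < \<tau>" "ball w0 \<tau> \<subseteq> D" using D open_contains_ball by blast
  \<comment> \<open>small enough for all starting points \<open>a z\<close> to lie within \<open>\<sigma>\<close> and \<open>\<tau>\<close> of \<open>w0\<close>\<close>
  define s where "s = min 1 (min \<sigma> \<tau> / (2 * (k * r)))"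
  have s: "0 < s" "s \<le> 1" using \<sigma> \<tau> k r by (auto simp: s_def)
  have skr: "s * (k * r) < \<sigma>" "s * (k * r) < \<tau>"
  proof -
    have "s * (k * r) \<le> min \<sigma> \<tau> / (2 * (k * r)) * (k * r)"
      using k r by (intro mult_right_mono) (auto simp: s_def)
    also have "\<dots> = min \<sigma> \<tau> / 2" using k r by simp
    finally show "s * (k * r) < \<sigma>" "s * (k * r) < \<tau>" using \<sigma> \<tau> by auto
  qed
  define a where "a z = w0 + s *\<^sub>R A z" for z
  define T where "T = - ln s"
  have T: "0 \<le> T" "exp T = 1 / s" using s by (auto simp: T_def exp_minus inverse_eq_divide)
  have az: "norm (a z - w0) \<le> s * (k * r)" if "z \<in> cball 0 r" for z
  proof -
    have "norm (A z) \<le> k * r" using order_trans[OF k(2)[of z] mult_right_mono[of "norm z" r k]] that k(1) by (simp add: mult.commute)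
    then show ?thesis using s by (simp add: a_def mult_left_mono)
  qed
  have aD: "a z \<in> D" if "z \<in> cball 0 r" for z
    using az[OF that] skr \<tau> by (auto simp: dist_norm norm_minus_commute subset_iff)
  have end_close: "norm ((1 / s) *\<^sub>R ?G (a z) - z) \<le> d" if z: "z \<in> cball 0 r" for z
  proof -
    have G0: "?G w0 = 0" using inv(2)[OF S0] by (simp add: w0_def)
    have "norm (?G (a z) - ?G w0 - B (a z - w0)) \<le> \<kappa> * norm (a z - w0)"
      using az[OF z] skr by (intro \<sigma>) auto
    also have "\<dots> \<le> \<kappa> * (s * (k * r))" using az[OF z] \<kappa> by (intro mult_left_mono) auto
    also have "\<dots> = s * d" using k r by (simp add: \<kappa>_def)
    finally have "norm (?G (a z) - s *\<^sub>R z) \<le> s * d"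
      by (simp add: G0 a_def linear_scale[OF bounded_linear.linear[OF bl(2)]] AB)
    moreover have "?G (a z) - s *\<^sub>R z = s *\<^sub>R ((1 / s) *\<^sub>R ?G (a z) - z)"
      using s by (simp add: algebra_simps)
    ultimately show ?thesis using s by simp
  qed
  have end_in: "norm ((1 / s) *\<^sub>R ?G (a z)) \<le> 2 * r" if z: "z \<in> cball 0 r" for z
    using end_close[OF z] norm_triangle_ineq[of "(1 / s) *\<^sub>R ?G (a z) - z" z] z d by simp
  have "\<exists>\<Phi>\<in>Aut. \<forall>z\<in>cball 0 r. norm (\<Phi> (F (exp 0 *\<^sub>R ?G (a z))) - F (exp T *\<^sub>R ?G (a z))) < \<eta>/2"
  proof (rule transported_time_map_approximable[where x="\<lambda>z t. exp t *\<^sub>R ?G (a z)" and Y="\<lambda>z. z",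
        OF card runge F S holomorphic_map_id _ r(2) T(1) _ _ half_gt_zero[OF \<eta>]])
    fix z :: "complex ^ 'n" and t assume z: "z \<in> cball 0 r" and t: "0 \<le> t" "t \<le> T"
    show "((\<lambda>t. exp t *\<^sub>R ?G (a z)) has_vector_derivative exp t *\<^sub>R ?G (a z)) (at t)"
      by (auto intro!: derivative_eq_intros)
    have "norm (exp t *\<^sub>R ?G (a z)) \<le> norm (exp T *\<^sub>R ?G (a z))"
      using t by (simp add: mult_right_mono)
    also have "\<dots> \<le> 2 * r" using end_in[OF z] T by simp
    finally show "exp t *\<^sub>R ?G (a z) \<in> cball 0 (2 * r)" by simp
  qed simp
  then obtain \<Phi> where \<Phi>: "\<Phi> \<in> Aut"
    "\<And>z. z \<in> cball 0 r \<Longrightarrow> norm (\<Phi> (F (?G (a z))) - F ((1 / s) *\<^sub>R ?G (a z))) < \<eta>/2"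
    using T by auto
  have "norm ((\<Phi> \<circ> a) z - F z) < \<eta>" if z: "z \<in> cball 0 r" for z
  proof -
    have "dist (F ((1 / s) *\<^sub>R ?G (a z))) (F z) < \<eta>/2"
      using end_close[OF z] end_in[OF z] z d r by (intro d0) (auto simp: dist_norm)
    moreover have "norm (\<Phi> (a z) - F ((1 / s) *\<^sub>R ?G (a z))) < \<eta>/2"
      using \<Phi>(2)[OF z] inv(4)[OF aD[OF z]] by simp
    ultimately show ?thesis
      using norm_triangle_ineq[of "\<Phi> (a z) - F ((1 / s) *\<^sub>R ?G (a z))" "F ((1 / s) *\<^sub>R ?G (a z)) - F z"]
      by (simp add: dist_norm)
  qed
  moreover have "holomorphic_automorphism a"
    unfolding a_def using s by (intro affine_automorphism[OF bl(1) A(2) bl(2) B(2) AB]) auto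
  then have "\<Phi> \<circ> a \<in> Aut" using \<Phi>(1) by (auto intro: holomorphic_automorphism_compose)
  ultimately show ?thesis by blast
qed

text \<open>
  Each point of \<open>K\<close> enters the ball \<open>ball 0 \<delta>\<close> of stability at some time, and so do the points near
  it at the same time; finitely many times suffice by compactness, and after the largest of them all
  points of \<open>K\<close> are within distance \<open>r\<close> of the origin, since no point leaves \<open>ball 0 r\<close> after
  entering \<open>ball 0 \<delta>\<close>.
\<close>

lemma uniform_attraction:
  assumes hol: "holomorphic_map_on V UNIV" and flow: "is_flow V \<phi>"
    and attr: "globally_attracting_origin V \<phi>" and K: "compact K" and r: "0 < r"
  shows "\<exists>T\<ge>0. \<forall>z\<in>K. norm (\<phi> T z) < r"
proof -
  obtain \<delta> where \<delta>: "0 < \<delta>" "\<And>z t. z \<in> ball 0 \<delta> \<Longrightarrow> 0 \<le> t \<Longrightarrow> \<phi> t z \<in> ball 0 r"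
    using attr r unfolding globally_attracting_origin_def by meson
  define U where "U T = (\<phi> T) -` ball 0 \<delta>" for T
  have U: "open (U T)" if "T \<in> {0..}" for T :: real
    unfolding U_def using flow_continuous_time_map[OF hol flow, of T UNIV] that
    by (intro open_vimage) auto
  have cover: "K \<subseteq> (\<Union>T\<in>{0..}. U T)"
  proof
    fix z assume "z \<in> K"
    have "((\<lambda>t. \<phi> t z) \<longlongrightarrow> 0) at_top" using attr by (simp add: globally_attracting_origin_def)
    then have "\<forall>\<^sub>F t in at_top. dist (\<phi> t z) 0 < \<delta>" using \<delta>(1) by (rule tendstoD)
    then obtain N where "\<And>t. N \<le> t \<Longrightarrow> dist (\<phi> t z) 0 < \<delta>"
      unfolding eventually_at_top_linorder by blast
    then have "0 \<le> max N 0" "\<phi> (max N 0) z \<in> ball 0 \<delta>" by (simp_all add: dist_commute)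
    then show "z \<in> (\<Union>T\<in>{0..}. U T)" unfolding U_def by blast
  qed
  obtain C where C: "C \<subseteq> {0..}" "finite C" "K \<subseteq> (\<Union>T\<in>C. U T)"
    by (rule compactE_image[OF K _ cover]) (rule U)
  define T where "T = Max (insert 0 C)"
  have T: "0 \<le> T" "\<And>s. s \<in> C \<Longrightarrow> s \<le> T" using C(2) by (auto simp: T_def)
  show ?thesis
  proof (intro exI[of _ T] conjI T ballI)
    fix z assume "z \<in> K"
    then obtain s where s: "s \<in> C" "\<phi> s z \<in> ball 0 \<delta>" using C(3) by (auto simp: U_def)
    then have "\<phi> (T - s) (\<phi> s z) \<in> ball 0 r" using T(2) by (intro \<delta>(2)) auto
    moreover have "\<phi> (T - s) (\<phi> s z) = \<phi> T z"
      using flow_semigroup[OF hol flow, of "T - s" s z] T(2)[OF s(1)] by simp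
    ultimately show "norm (\<phi> T z) < r" by simp
  qed
qed

text \<open>
  The outer automorphism is chosen first. It is uniformly continuous near \<open>G ` K\<close>, which fixes the
  precision that is needed for the inner one.
\<close>

lemma approximation_compose:
  fixes G :: "complex ^ 'n \<Rightarrow> complex ^ 'n"
  assumes K: "compact K" and G: "continuous_on K G"
    and outer: "\<exists>\<Phi>\<in>Aut. \<forall>z\<in>K. norm (\<Phi> (G z) - H z) < \<eta>/2"
    and inner: "\<And>\<epsilon>. 0 < \<epsilon> \<Longrightarrow> \<exists>\<Phi>\<in>Aut. \<forall>z\<in>K. norm (\<Phi> z - G z) < \<epsilon>"
    and \<eta>: "0 < \<eta>"
  shows "\<exists>\<Phi>\<in>Aut. \<forall>z\<in>K. norm (\<Phi> z - H z) < \<eta>"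
proof -
  obtain \<Phi>2 where \<Phi>2: "\<Phi>2 \<in> Aut" "\<And>z. z \<in> K \<Longrightarrow> norm (\<Phi>2 (G z) - H z) < \<eta>/2"
    using outer by blast
  define N where "N = {x. \<exists>z\<in>G ` K. norm (x - z) \<le> 1}"
  have "compact N"
    unfolding N_def by (intro compact_closed_neighbourhood compact_continuous_image G K)
  moreover have "continuous_on N \<Phi>2"
    using \<Phi>2(1) by (auto intro: holomorphic_map_on_continuous holomorphic_map_on_subset holomorphic_automorphism_holomorphic)
  ultimately have "uniformly_continuous_on N \<Phi>2" by (rule compact_uniformly_continuous[rotated])
  then obtain d where d: "0 < d" "\<And>x x'. x \<in> N \<Longrightarrow> x' \<in> N \<Longrightarrow> dist x' x < d \<Longrightarrow> dist (\<Phi>2 x') (\<Phi>2 x) < \<eta>/2"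
    using half_gt_zero[OF \<eta>] unfolding uniformly_continuous_on_def by meson
  obtain \<Phi>1 where \<Phi>1: "\<Phi>1 \<in> Aut" "\<And>z. z \<in> K \<Longrightarrow> norm (\<Phi>1 z - G z) < min 1 d"
    using inner[of "min 1 d"] d by auto
  have "norm ((\<Phi>2 \<circ> \<Phi>1) z - H z) < \<eta>" if z: "z \<in> K" for z
  proof -
    have near: "norm (\<Phi>1 z - G z) \<le> 1" "dist (\<Phi>1 z) (G z) < d" using \<Phi>1(2)[OF z] by (auto simp: dist_norm)
    have "G z \<in> N" "\<Phi>1 z \<in> N"
      unfolding N_def using near(1) by (intro CollectI bexI[OF _ imageI[OF z]]; simp)+
    from d(2)[OF this near(2)] have "dist (\<Phi>2 (\<Phi>1 z)) (\<Phi>2 (G z)) < \<eta>/2" .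
    then show ?thesis
      using \<Phi>2(2)[OF z] norm_triangle_ineq[of "\<Phi>2 (\<Phi>1 z) - \<Phi>2 (G z)" "\<Phi>2 (G z) - H z"]
      by (simp add: dist_norm)
  qed
  moreover have "\<Phi>2 \<circ> \<Phi>1 \<in> Aut" using \<Phi>1(1) \<Phi>2(1) by (auto intro: holomorphic_automorphism_compose)
  ultimately show ?thesis by blast
qed

theorem theorem1p1:
  fixes V :: "complex ^ 'n \<Rightarrow> complex ^ 'n"
    and \<phi> :: "real \<Rightarrow> complex ^ 'n \<Rightarrow> complex ^ 'n"
    and \<Omega> \<Omega>' :: "(complex ^ 'n) set"
    and F :: "complex ^ 'n \<Rightarrow> complex ^ 'n"
  assumes "CARD('n) > 1"
    and "complete_holomorphic_field V"
    and "is_flow V \<phi>"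
    and "globally_attracting_origin V \<phi>"
    and "is_domain \<Omega>" and "0 \<in> \<Omega>"
    and "positively_invariant \<phi> \<Omega>"
    and "runge_domain \<Omega>'"
    and "biholomorphic_onto F \<Omega> \<Omega>'"
  shows "\<forall>K \<eta>. compact K \<and> K \<subseteq> \<Omega> \<and> \<eta> > 0 \<longrightarrow>
           (\<exists>\<Phi>. holomorphic_automorphism \<Phi> \<and> (\<forall>z\<in>K. norm (\<Phi> z - F z) < \<eta>))"
proof (intro allI impI, elim conjE)
  fix K :: "(complex ^ 'n) set" and \<eta> :: real
  assume K: "compact K" "K \<subseteq> \<Omega>" and \<eta>: "0 < \<eta>"
  note flow = \<open>is_flow V \<phi>\<close> and runge = \<open>runge_domain \<Omega>'\<close> and F = \<open>biholomorphic_onto F \<Omega> \<Omega>'\<close>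
  have hol: "holomorphic_map_on V UNIV"
    using assms(2) by (simp add: complete_holomorphic_field_def)
  have \<Omega>: "open \<Omega>" using assms(5) by (simp add: is_domain_def)
  have inv: "\<phi> t z \<in> \<Omega>" if "0 \<le> t" "z \<in> \<Omega>" for t z
    using assms(7) that by (simp add: positively_invariant_def)
  obtain r0 where r0: "0 < r0" "cball 0 r0 \<subseteq> \<Omega>"
    using \<Omega> \<open>0 \<in> \<Omega>\<close> open_contains_cball by blast
  define r where "r = r0 / 2"
  have r: "0 < r" "cball 0 (2 * r) \<subseteq> \<Omega>" using r0 by (auto simp: r_def)
  obtain T where T: "0 \<le> T" "\<And>z. z \<in> K \<Longrightarrow> norm (\<phi> T z) < r"
    using uniform_attraction[OF hol flow assms(4) K(1) r(1)] by blast
  have F_cont: "continuous_on \<Omega> F"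
    using F by (auto simp: biholomorphic_onto_def intro: holomorphic_map_on_continuous)
  have "\<exists>\<Phi>\<in>Aut. \<forall>z\<in>K. norm (\<Phi> z - F z) < \<eta>"
  proof (rule approximation_compose[where G="\<lambda>z. F (\<phi> T z)", OF K(1) _ _ _ \<eta>])
    show "continuous_on K (\<lambda>z. F (\<phi> T z))"
      by (rule continuous_on_compose2[OF F_cont flow_continuous_time_map[OF hol flow T(1)]])
        (use inv T K in auto)
    define Q where "Q = {\<phi> t z |t z. t \<in> {0..T} \<and> z \<in> K}"
    have Q: "compact Q" "Q \<subseteq> \<Omega>"
      unfolding Q_def using flow_compact_tube[OF hol flow T(1) K(1)] inv K by auto
    have negV: "holomorphic_map_on (\<lambda>z. - V z) \<Omega>"
      using holomorphic_map_scaleR[OF holomorphic_map_on_subset[OF hol subset_UNIV], where r="-1"] by simp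
    have "\<exists>\<Phi>\<in>Aut. \<forall>z\<in>K. norm (\<Phi> (F (\<phi> (T - 0) z)) - F (\<phi> (T - T) z)) < \<eta>/2"
    proof (rule transported_time_map_approximable[where x="\<lambda>z t. \<phi> (T - t) z",
          OF assms(1) runge F \<Omega> negV Q T(1) _ _ half_gt_zero[OF \<eta>]])
      show "((\<lambda>t. \<phi> (T - t) z) has_vector_derivative - V (\<phi> (T - t) z)) (at t)" for z t
        by (rule has_vector_derivative_reverse_time) (rule flow_derivative[OF hol flow])
      show "\<phi> (T - t) z \<in> Q" if "z \<in> K" "0 \<le> t" "t \<le> T" for z t
      proof -
        have "T - t \<in> {0..T}" using that by simp
        then show ?thesis unfolding Q_def using that(1) by blast
      qed
    qed
    then show "\<exists>\<Phi>\<in>Aut. \<forall>z\<in>K. norm (\<Phi> (F (\<phi> T z)) - F z) < \<eta>/2"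
      by (simp add: flow_zero[OF hol flow])
    fix \<epsilon> :: real assume "0 < \<epsilon>"
    then obtain \<Phi> where \<Phi>: "\<Phi> \<in> Aut" "\<And>z. z \<in> cball 0 r \<Longrightarrow> norm (\<Phi> z - F z) < \<epsilon>"
      using approximable_near_origin[OF assms(1) runge F \<Omega> r] by blast
    have "\<Phi> \<circ> \<phi> T \<in> Aut"
      using \<Phi>(1) flow_automorphism[OF hol flow T(1)] by (auto intro: holomorphic_automorphism_compose)
    moreover have "\<forall>z\<in>K. norm ((\<Phi> \<circ> \<phi> T) z - F (\<phi> T z)) < \<epsilon>"
      using \<Phi>(2) T(2) by (auto intro: less_imp_le)
    ultimately show "\<exists>\<Phi>\<in>Aut. \<forall>z\<in>K. norm (\<Phi> z - F (\<phi> T z)) < \<epsilon>" by blast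
  qed
  then show "\<exists>\<Phi>. holomorphic_automorphism \<Phi> \<and> (\<forall>z\<in>K. norm (\<Phi> z - F z) < \<eta>)" by blast
qed

end
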